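(* Let $M_1,M_2$ be structures in the same relational vocabulary $\tau$ (no function or constant symbols). If $\mathrm{Th}(M_1)$ and $\mathrm{Th}(M_2)$ are strongly dependent$^1$, then $\mathrm{Th}(M_1\oplus M_2)$ is strongly dependent$^1$.
   Context: For structures $M,N$ in a relational vocabulary $\tau$ with disjoint universes, $M\oplus N$ is the structure in vocabulary $\tau\cup\{L,R\}$ ($L,R$ new unary predicates) with universe $|M|\cup|N|$, $S^{M\oplus N}=S^M\cup S^N$ for each $S\in\tau$, $L^{M\oplus N}=|M|$ and $R^{M\oplus N}=|N|$. A complete theory $T$ is strongly dependent$^1$ iff there is no sequence of formulas $\langle \varphi_i(\bar x,\bar y_i): i<\omega\rangle$ such that the set $\{\varphi_i(\bar x_\eta,\bar y_i^j)^{\mathrm{if}(\eta(i)=j)}: i<\omega,\ j<\omega,\ \eta\in{}^{\omega}\omega\}$ is consistent with $T$, where $\bar x_\eta$, $\bar y_i^j$ are pairwise distinct tuples of variables, $\varphi^{\mathrm{if}(\text{true})}=\varphi$ and $\varphi^{\mathrm{if}(\text{false})}=\neg\varphi$. *)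

theory Defs
  imports Main
begin

section \<open>Relational vocabularies and structures\<close>

text \<open>
  A vocabulary is the set of symbols on which the partial function is defined, together with
  their arities. A partial function is used, rather than taking all of the type \<open>'r\<close>,
  so that the empty vocabulary is covered as well.
\<close>

type_synonym 'r vocab = "'r \<Rightarrow> nat option"

record ('r, 'a) fo_struct =
  univ :: "'a set"
  rel :: "'r \<Rightarrow> 'a list set"

definition is_structure :: "'r vocab \<Rightarrow> ('r, 'a) fo_struct \<Rightarrow> bool" where
  "is_structure \<tau> M \<longleftrightarrow> univ M \<noteq> {} \<and>
     (\<forall>S n. \<tau> S = Some n \<longrightarrow> rel M S \<subseteq> {as. length as = n \<and> set as \<subseteq> univ M})"

datatype 'r lr_sym = Sym 'r | LPred | RPred

definition sum_vocab :: "'r vocab \<Rightarrow> 'r lr_sym vocab" where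
  "sum_vocab \<tau> s = (case s of Sym S \<Rightarrow> \<tau> S | LPred \<Rightarrow> Some 1 | RPred \<Rightarrow> Some 1)"

definition struct_sum ::
    "('r, 'a) fo_struct \<Rightarrow> ('r, 'a) fo_struct \<Rightarrow> ('r lr_sym, 'a) fo_struct" (infixl "\<oplus>" 65) where
  "M \<oplus> N =
     \<lparr> univ = univ M \<union> univ N,
       rel = (\<lambda>s. case s of
                Sym S \<Rightarrow> rel M S \<union> rel N S
              | LPred \<Rightarrow> {[a] |a. a \<in> univ M}
              | RPred \<Rightarrow> {[a] |a. a \<in> univ N}) \<rparr>"


section \<open>First-order formulas with equality\<close>

text \<open>
  Locally nameless syntax: free variables carry a name from an arbitrary type \<open>'v\<close>, bound
  variables are de Bruijn indices. Hence \<open>map_fm id g\<close> substitutes the variable \<open>g v\<close> for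
  each free variable \<open>v\<close>, without any capture, and \<open>fm_frees\<close> is the set of free variables.
\<close>

datatype 'v tm = Fr 'v | Bd nat

datatype (fm_syms: 'r, fm_frees: 'v) fm =
    Bot
  | Eql "'v tm" "'v tm"
  | Rel 'r "'v tm list"
  | Imp "('r, 'v) fm" "('r, 'v) fm"
  | All "('r, 'v) fm"

abbreviation Neg :: "('r, 'v) fm \<Rightarrow> ('r, 'v) fm" where
  "Neg p \<equiv> Imp p Bot"

fun tm_ok :: "nat \<Rightarrow> 'v tm \<Rightarrow> bool" where
  "tm_ok d (Fr v) \<longleftrightarrow> True"
| "tm_ok d (Bd i) \<longleftrightarrow> i < d"

text \<open>The formulas of the language are the \<open>p\<close> with \<open>wff \<tau> 0 p\<close>; \<open>wff \<tau> d p\<close> allows the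
  \<open>d\<close> outermost indices to be unbound.\<close>

primrec wff :: "'r vocab \<Rightarrow> nat \<Rightarrow> ('r, 'v) fm \<Rightarrow> bool" where
  "wff \<tau> d Bot \<longleftrightarrow> True"
| "wff \<tau> d (Eql s t) \<longleftrightarrow> tm_ok d s \<and> tm_ok d t"
| "wff \<tau> d (Rel S ts) \<longleftrightarrow> \<tau> S = Some (length ts) \<and> (\<forall>t \<in> set ts. tm_ok d t)"
| "wff \<tau> d (Imp p q) \<longleftrightarrow> wff \<tau> d p \<and> wff \<tau> d q"
| "wff \<tau> d (All p) \<longleftrightarrow> wff \<tau> (Suc d) p"

definition sentence :: "'r vocab \<Rightarrow> ('r, 'v) fm \<Rightarrow> bool" where
  "sentence \<tau> p \<longleftrightarrow> wff \<tau> 0 p \<and> fm_frees p = {}"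

fun tm_val :: "('v \<Rightarrow> 'a) \<Rightarrow> 'a list \<Rightarrow> 'v tm \<Rightarrow> 'a" where
  "tm_val s e (Fr v) = s v"
| "tm_val s e (Bd i) = e ! i"

primrec sat :: "('r, 'a) fo_struct \<Rightarrow> ('v \<Rightarrow> 'a) \<Rightarrow> 'a list \<Rightarrow> ('r, 'v) fm \<Rightarrow> bool" where
  "sat M s e Bot \<longleftrightarrow> False"
| "sat M s e (Eql t u) \<longleftrightarrow> tm_val s e t = tm_val s e u"
| "sat M s e (Rel S ts) \<longleftrightarrow> map (tm_val s e) ts \<in> rel M S"
| "sat M s e (Imp p q) \<longleftrightarrow> (sat M s e p \<longrightarrow> sat M s e q)"
| "sat M s e (All p) \<longleftrightarrow> (\<forall>a \<in> univ M. sat M s (a # e) p)"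

definition Th :: "'r vocab \<Rightarrow> ('r, 'a) fo_struct \<Rightarrow> ('r, nat) fm set" where
  "Th \<tau> M = {p. sentence \<tau> p \<and> (\<forall>s. range s \<subseteq> univ M \<longrightarrow> sat M s [] p)}"


section \<open>Provability and consistency\<close>

fun tm_open :: "nat \<Rightarrow> 'v \<Rightarrow> 'v tm \<Rightarrow> 'v tm" where
  "tm_open k a (Fr v) = Fr v"
| "tm_open k a (Bd i) = (if i = k then Fr a else Bd i)"

primrec fm_open :: "nat \<Rightarrow> 'v \<Rightarrow> ('r, 'v) fm \<Rightarrow> ('r, 'v) fm" where
  "fm_open k a Bot = Bot"
| "fm_open k a (Eql s t) = Eql (tm_open k a s) (tm_open k a t)"
| "fm_open k a (Rel S ts) = Rel S (map (tm_open k a) ts)"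
| "fm_open k a (Imp p q) = Imp (fm_open k a p) (fm_open k a q)"
| "fm_open k a (All p) = All (fm_open (Suc k) a p)"

text \<open>\<open>prop_val v\<close> treats atomic and universally quantified formulas as propositional variables.\<close>

primrec prop_val :: "(('r, 'v) fm \<Rightarrow> bool) \<Rightarrow> ('r, 'v) fm \<Rightarrow> bool" where
  "prop_val v Bot \<longleftrightarrow> False"
| "prop_val v (Eql s t) \<longleftrightarrow> v (Eql s t)"
| "prop_val v (Rel S ts) \<longleftrightarrow> v (Rel S ts)"
| "prop_val v (Imp p q) \<longleftrightarrow> (prop_val v p \<longrightarrow> prop_val v q)"
| "prop_val v (All p) \<longleftrightarrow> v (All p)"

text \<open>
  The usual Hilbert system for first-order logic with equality, sound and complete for nonempty
  structures. In a relational vocabulary the only terms are variables, so that the axioms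
  instantiate by variables only. The type \<open>'v\<close> is meant to be infinite, so that rule \<open>gen\<close>
  always finds a fresh variable.
\<close>

inductive provable :: "'r vocab \<Rightarrow> ('r, 'v) fm \<Rightarrow> bool" for \<tau> :: "'r vocab" where
  taut: "wff \<tau> 0 p \<Longrightarrow> \<forall>v. prop_val v p \<Longrightarrow> provable \<tau> p"
| inst: "wff \<tau> 1 p \<Longrightarrow> provable \<tau> (Imp (All p) (fm_open 0 a p))"
| eq_refl: "provable \<tau> (Eql (Fr a) (Fr a))"
| eq_subst: "wff \<tau> 1 p \<Longrightarrow>
    provable \<tau> (Imp (Eql (Fr a) (Fr b)) (Imp (fm_open 0 a p) (fm_open 0 b p)))"
| mp: "provable \<tau> (Imp p q) \<Longrightarrow> provable \<tau> p \<Longrightarrow> provable \<tau> q"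
| gen: "wff \<tau> 0 q \<Longrightarrow> wff \<tau> 1 p \<Longrightarrow> a \<notin> fm_frees q \<Longrightarrow> a \<notin> fm_frees p \<Longrightarrow>
    provable \<tau> (Imp q (fm_open 0 a p)) \<Longrightarrow> provable \<tau> (Imp q (All p))"

text \<open>Hypotheses are discharged before rule \<open>gen\<close> can be applied, so free variables of
  \<open>\<Gamma>\<close> act as constants, and they may exhaust the type \<open>'v\<close>.\<close>

definition consistent :: "'r vocab \<Rightarrow> ('r, 'v) fm set \<Rightarrow> bool" where
  "consistent \<tau> \<Gamma> \<longleftrightarrow> \<not> (\<exists>ps. set ps \<subseteq> \<Gamma> \<and> provable \<tau> (foldr Imp ps Bot))"

text \<open>The renaming only moves the sentences of \<open>T\<close> to the syntax with free variables from
  \<open>'v\<close>: they have no free variables, so its value is irrelevant.\<close>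

definition consistent_with ::
    "'r vocab \<Rightarrow> ('r, nat) fm set \<Rightarrow> ('r, 'v) fm set \<Rightarrow> bool" where
  "consistent_with \<tau> T \<Gamma> \<longleftrightarrow> consistent \<tau> (map_fm id (\<lambda>_. undefined) ` T \<union> \<Gamma>)"


section \<open>Strong dependence\<close>

text \<open>\<open>XVar \<eta> m\<close> is the \<open>m\<close>-th entry of the tuple indexed by \<open>\<eta>\<close>, and \<open>YVar i j m\<close> the \<open>m\<close>-th
  entry of the \<open>j\<close>-th copy of the parameter tuple of the \<open>i\<close>-th formula.\<close>

datatype pat_var = XVar "nat \<Rightarrow> nat" nat | YVar nat nat nat

text \<open>In a formula over the variables \<open>0, 1, \<dots>\<close> the tuple \<open>x\<close> consists of the first \<open>n\<close>
  variables and the tuple \<open>y\<close> of the following ones.\<close>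

definition pat_inst ::
    "nat \<Rightarrow> (nat \<Rightarrow> nat) \<Rightarrow> nat \<Rightarrow> nat \<Rightarrow> ('r, nat) fm \<Rightarrow> ('r, pat_var) fm" where
  "pat_inst n \<eta> i j p = map_fm id (\<lambda>v. if v < n then XVar \<eta> v else YVar i j (v - n)) p"

definition fm_if :: "bool \<Rightarrow> ('r, 'v) fm \<Rightarrow> ('r, 'v) fm" where
  "fm_if b p = (if b then p else Neg p)"

definition strongly_dependent1 :: "'r vocab \<Rightarrow> ('r, nat) fm set \<Rightarrow> bool" where
  "strongly_dependent1 \<tau> T \<longleftrightarrow>
     \<not> (\<exists>(n :: nat) (k :: nat \<Rightarrow> nat) (\<phi> :: nat \<Rightarrow> ('r, nat) fm).
          (\<forall>i. wff \<tau> 0 (\<phi> i) \<and> fm_frees (\<phi> i) \<subseteq> {..<n + k i}) \<and>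
          consistent_with \<tau> T {fm_if (\<eta> i = j) (pat_inst n \<eta> i j (\<phi> i)) |i j \<eta>. True})"

end

theory Submission
  imports Defs "HOL-Library.Ramsey" "HOL-Library.Infinite_Set"
begin

text \<open>
  Consistency with \<open>Th M\<close> means finite satisfiability in \<open>M\<close>, so a failure of strong dependence is
  a family of finite patterns in \<open>M\<close>, for one sequence of formulas \<open>\<phi>\<^sub>i\<close>. In \<open>M\<^sub>1 \<oplus> M\<^sub>2\<close> the truth
  value of \<open>\<phi>\<^sub>i\<close> depends only on the sides of the elements and on the truth values of finitely many
  \<open>\<tau>\<close>-formulas at the left and at the right components. A product Ramsey argument makes
  these types depend, for \<open>(a\<^sub>\<eta>, b\<^sub>i\<^sup>j)\<close>, only on the order of \<open>j\<close> and \<open>\<eta> i\<close>. As \<open>\<phi>\<^sub>i\<close> separates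
  \<open>j < \<eta> i\<close> from \<open>j = \<eta> i\<close>, so does the left or the right type, and the formula saying that two
  consecutive columns have different types yields row \<open>i\<close> of a pattern in \<open>M\<^sub>1\<close> or in \<open>M\<^sub>2\<close>. By
  Koenig's lemma the choice of the side can be made independently of the size of the pattern, and
  one side is chosen infinitely often.
\<close>

section \<open>Consistency with a complete theory\<close>

lemma tm_val_map: "tm_val s e (map_tm g t) = tm_val (s \<circ> g) e t"
  by (cases t) auto

lemma sat_map_fm: "sat M s e (map_fm id g p) \<longleftrightarrow> sat M (s \<circ> g) e p"
  by (induction p arbitrary: e) (auto simp: tm_val_map comp_def)

lemma tm_ok_map [simp]: "tm_ok d (map_tm g t) = tm_ok d t"
  by (cases t) auto

lemma wff_map_fm [simp]: "wff \<tau> d (map_fm id g p) \<longleftrightarrow> wff \<tau> d p"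
  by (induction p arbitrary: d) auto

lemma tm_val_cong: "(\<And>v. v \<in> set_tm t \<Longrightarrow> s v = s' v) \<Longrightarrow> tm_val s e t = tm_val s' e t"
  by (cases t) auto

lemma sat_cong:
  "(\<And>v. v \<in> fm_frees p \<Longrightarrow> s v = s' v) \<Longrightarrow> sat M s e p \<longleftrightarrow> sat M s' e p"
proof (induction p arbitrary: e)
  case (Eql t u)
  then show ?case using tm_val_cong[of t s s' e] tm_val_cong[of u s s' e] by auto
next
  case (Rel S ts)
  have "map (tm_val s e) ts = map (tm_val s' e) ts"
    using Rel by (intro map_cong refl tm_val_cong) auto
  then show ?case by (simp only: sat.simps)
next
  case (Imp p q)
  then show ?case by (metis UnCI fm.set(9) sat.simps(4))
next
  case (All p)
  then show ?case by auto
qed simp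

lemma tm_val_open:
  "tm_ok (Suc (length e)) t \<Longrightarrow> tm_val s e (tm_open (length e) a t) = tm_val s (e @ [s a]) t"
  by (cases t) (auto simp: nth_append)

lemma sat_open:
  "wff \<tau> (Suc (length e)) p \<Longrightarrow>
    sat M s e (fm_open (length e) a p) \<longleftrightarrow> sat M s (e @ [s a]) p"
proof (induction p arbitrary: e)
  case (Rel S ts)
  have "map (tm_val s e \<circ> tm_open (length e) a) ts = map (tm_val s (e @ [s a])) ts"
    using Rel by (intro map_cong refl) (auto simp: tm_val_open)
  then show ?case by (simp only: sat.simps fm_open.simps map_map)
next
  case (All p)
  have "sat M s (x # e) (fm_open (Suc (length e)) a p) \<longleftrightarrow> sat M s (x # e @ [s a]) p" for x
    using All.IH[of "x # e"] All.prems by simp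
  then show ?case by simp
qed (auto simp: tm_val_open)

lemma prop_val_sat: "prop_val (sat M s e) p \<longleftrightarrow> sat M s e p"
  by (induction p) auto

lemma provable_sound: "provable \<tau> p \<Longrightarrow> range s \<subseteq> univ M \<Longrightarrow> sat M s [] p"
proof (induction arbitrary: s rule: provable.induct)
  case (taut p)
  then show ?case using prop_val_sat by blast
next
  case (inst p a)
  then show ?case using sat_open[of \<tau> "[]" p M s a] by auto
next
  case (eq_subst p a b)
  then show ?case using sat_open[of \<tau> "[]" p M s a] sat_open[of \<tau> "[]" p M s b] by auto
next
  case (gen q p a)
  have "sat M s [x] p" if "sat M s [] q" "x \<in> univ M" for x
  proof -
    \<comment> \<open>The variable \<open>a\<close> is fresh for \<open>q\<close> and
      \<open>p\<close>, so moving it to the arbitrary element \<open>x\<close> keeps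
      \<open>q\<close> true, and the induction hypothesis then speaks about
      \<open>x\<close>.\<close>
    let ?s = "s(a := x)"
    have "range ?s \<subseteq> univ M" using gen.prems that by auto
    moreover have "sat M ?s [] q"
      using that gen.hyps sat_cong[of q s ?s M "[]"] by (metis fun_upd_other)
    ultimately have "sat M ?s [] (fm_open 0 a p)" using gen.IH[of ?s] by (simp add: fun_upd_def)
    then have "sat M ?s [x] p" using sat_open[of \<tau> "[]" p M ?s a] gen.hyps by simp
    then show ?thesis using gen.hyps sat_cong[of p s ?s M "[x]"] by (metis fun_upd_other)
  qed
  then show ?case by simp
qed auto

section \<open>Abstraction of named variables and universal closures\<close>

fun tm_close :: "nat \<Rightarrow> 'v \<Rightarrow> 'v tm \<Rightarrow> 'v tm" where
  "tm_close k a (Fr v) = (if v = a then Bd k else Fr v)"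
| "tm_close k a (Bd i) = Bd i"

primrec fm_close :: "nat \<Rightarrow> 'v \<Rightarrow> ('r, 'v) fm \<Rightarrow> ('r, 'v) fm" where
  "fm_close k a Bot = Bot"
| "fm_close k a (Eql s t) = Eql (tm_close k a s) (tm_close k a t)"
| "fm_close k a (Rel S ts) = Rel S (map (tm_close k a) ts)"
| "fm_close k a (Imp p q) = Imp (fm_close k a p) (fm_close k a q)"
| "fm_close k a (All p) = All (fm_close (Suc k) a p)"

lemma tm_open_close: "tm_ok k t \<Longrightarrow> tm_open k a (tm_close k a t) = t"
  by (cases t) auto

text \<open>Well-formedness at depth \<open>k\<close> leaves no occurrence of the index being
  introduced. Hence abstraction needs no shifting, and opening removes exactly what abstraction
  inserted.\<close>

lemma fm_open_close: "wff \<tau> k p \<Longrightarrow> fm_open k a (fm_close k a p) = p"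
  by (induction p arbitrary: k) (auto simp: tm_open_close intro!: map_idI)

lemma tm_ok_close: "tm_ok k t \<Longrightarrow> tm_ok (Suc k) (tm_close k a t)"
  by (cases t) auto

lemma wff_close: "wff \<tau> k p \<Longrightarrow> wff \<tau> (Suc k) (fm_close k a p)"
  by (induction p arbitrary: k) (auto simp: tm_ok_close)

lemma set_tm_close: "set_tm (tm_close k a t) = set_tm t - {a}"
  by (cases t) auto

lemma fm_frees_close: "fm_frees (fm_close k a p) = fm_frees p - {a}"
  by (induction p arbitrary: k) (auto simp: set_tm_close)

lemma tm_val_close:
  "tm_ok (length e) t \<Longrightarrow> tm_val s (e @ [x]) (tm_close (length e) a t) = tm_val (s(a := x)) e t"
  by (cases t) (auto simp: nth_append)

lemma sat_close:
  "wff \<tau> (length e) p \<Longrightarrow>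
    sat M s (e @ [x]) (fm_close (length e) a p) \<longleftrightarrow> sat M (s(a := x)) e p"
proof (induction p arbitrary: e)
  case (Rel S ts)
  have "map (tm_val s (e @ [x]) \<circ> tm_close (length e) a) ts = map (tm_val (s(a := x)) e) ts"
    using Rel by (intro map_cong refl) (auto simp: tm_val_close)
  then show ?case by (simp only: sat.simps fm_close.simps map_map)
next
  case (All p)
  have "sat M s (y # e @ [x]) (fm_close (Suc (length e)) a p) \<longleftrightarrow> sat M (s(a := x)) (y # e) p" for y
    using All.IH[of "y # e"] All.prems by (simp add: fun_upd_def)
  then show ?case by (simp add: fun_upd_def)
qed (auto simp: tm_val_close)

fun univ_closure :: "'v list \<Rightarrow> ('r, 'v) fm \<Rightarrow> ('r, 'v) fm" where
  "univ_closure [] p = p"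
| "univ_closure (a # as) p = All (fm_close 0 a (univ_closure as p))"

lemma wff_univ_closure: "wff \<tau> 0 p \<Longrightarrow> wff \<tau> 0 (univ_closure as p)"
  by (induction as) (auto simp: wff_close)

lemma fm_frees_univ_closure: "fm_frees (univ_closure as p) = fm_frees p - set as"
  by (induction as) (auto simp: fm_frees_close)

lemma sat_univ_closure:
  assumes "wff \<tau> 0 p" and "\<And>s. range s \<subseteq> univ M \<Longrightarrow> sat M s [] p" and "range s \<subseteq> univ M"
  shows "sat M s [] (univ_closure as p)"
  using assms(3)
proof (induction as arbitrary: s)
  case (Cons a as)
  have "sat M s [x] (fm_close 0 a (univ_closure as p))" if "x \<in> univ M" for x
  proof -
    have "range (s(a := x)) \<subseteq> univ M" using Cons.prems that by auto
    then show ?thesis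
      using Cons.IH sat_close[of \<tau> "[]" "univ_closure as p" M s x a] wff_univ_closure[OF assms(1)]
      by simp
  qed
  then show ?case by simp
qed (use assms in simp)

lemma provable_Imp_trans:
  assumes "provable \<tau> (Imp p q)" and "provable \<tau> (Imp q r)"
    and "wff \<tau> 0 p" and "wff \<tau> 0 q" and "wff \<tau> 0 r"
  shows "provable \<tau> (Imp p r)"
proof -
  have "provable \<tau> (Imp (Imp p q) (Imp (Imp q r) (Imp p r)))"
    by (rule provable.taut) (use assms in auto)
  then show ?thesis using assms(1,2) provable.mp by blast
qed

text \<open>The quantifiers are peeled off one by one: axiom \<open>inst\<close>, applied to the
  very variable that was abstracted, gives the formula back by \<open>fm_open_close\<close>.\<close>

lemma provable_univ_closure_inst:
  assumes "wff \<tau> 0 p"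
  shows "provable \<tau> (Imp (univ_closure as p) p)"
proof (induction as)
  case Nil
  then show ?case by (auto intro!: provable.taut assms)
next
  case (Cons a as)
  let ?q = "univ_closure as p"
  have w: "wff \<tau> 0 ?q" by (rule wff_univ_closure[OF assms])
  have "provable \<tau> (Imp (All (fm_close 0 a ?q)) (fm_open 0 a (fm_close 0 a ?q)))"
    using wff_close[OF w] by (intro provable.inst) simp
  then have "provable \<tau> (Imp (All (fm_close 0 a ?q)) ?q)" using fm_open_close[OF w] by metis
  then show ?case
    using provable_Imp_trans[OF _ Cons] w assms wff_close[OF w] by simp
qed

lemma finite_fm_frees: "finite (fm_frees p)"
proof -
  have "finite (set_tm t)" for t :: "'b tm" by (cases t) auto
  then show ?thesis by (induction p) auto
qed

lemma sat_foldr_Imp: "sat M s e (foldr Imp ps q) \<longleftrightarrow> ((\<forall>p\<in>set ps. sat M s e p) \<longrightarrow> sat M s e q)"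
  by (induction ps) auto

lemma wff_foldr_Imp: "wff \<tau> d (foldr Imp ps q) \<longleftrightarrow> (\<forall>p\<in>set ps. wff \<tau> d p) \<and> wff \<tau> d q"
  by (induction ps) auto

text \<open>If \<open>ps\<close> is unsatisfiable, then the universal closure of \<open>foldr Imp ps Bot\<close> belongs to the theory and
  refutes \<open>ps\<close>; hence the completeness theorem is not needed.\<close>

lemma consistent_with_Th_imp_sat:
  fixes \<Gamma> :: "('r, 'v) fm set"
  assumes con: "consistent_with \<tau> (Th \<tau> M) \<Gamma>" and ps: "set ps \<subseteq> \<Gamma>" "\<forall>p\<in>set ps. wff \<tau> 0 p"
  obtains s where "range s \<subseteq> univ M" "\<forall>p\<in>set ps. sat M s [] p"
proof -
  let ?q = "foldr Imp ps Bot"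
  obtain vs where vs: "set vs = fm_frees ?q" using finite_fm_frees finite_list by metis
  define Q where "Q = univ_closure vs ?q"
  have w: "wff \<tau> 0 ?q" using ps by (simp add: wff_foldr_Imp)
  have frees: "fm_frees Q = {}" by (simp add: Q_def fm_frees_univ_closure vs)
  have "\<exists>s. range s \<subseteq> univ M \<and> \<not> sat M s [] ?q"
  proof (rule ccontr)
    assume "\<not> ?thesis"
    then have satQ: "sat M s [] Q" if "range s \<subseteq> univ M" for s
      unfolding Q_def using sat_univ_closure[OF w] that by blast
    \<comment> \<open>The theory lives in the syntax with names in \<open>nat\<close>. As
      \<open>Q\<close> has no free variables, it can be moved to that syntax and back without
      change.\<close>
    define Q' :: "('r, nat) fm" where "Q' = map_fm id (\<lambda>_. 0) Q"
    have "sat M s [] Q'" if "range s \<subseteq> univ M" for s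
      unfolding Q'_def sat_map_fm by (rule satQ) (use that in auto)
    moreover have "sentence \<tau> Q'"
      unfolding sentence_def Q'_def using w frees by (simp add: fm.set_map wff_univ_closure Q_def)
    ultimately have "Q' \<in> Th \<tau> M" by (simp add: Th_def)
    moreover have "map_fm id (\<lambda>_. undefined) Q' = Q"
      unfolding Q'_def fm.map_comp comp_def id_def
      by (rule trans[OF fm.map_cong fm.map_ident]) (use frees in auto)
    ultimately have "set (Q # ps) \<subseteq> map_fm id (\<lambda>_. undefined) ` Th \<tau> M \<union> \<Gamma>"
      using ps by (auto intro: rev_image_eqI)
    \<comment> \<open>Folding \<open>Q # ps\<close> yields the implication from the closure
      \<open>Q\<close> to \<open>?q\<close> itself.\<close>
    moreover have "provable \<tau> (foldr Imp (Q # ps) Bot)"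
      using provable_univ_closure_inst[OF w] by (simp add: Q_def)
    ultimately show False using con unfolding consistent_with_def consistent_def by blast
  qed
  then show ?thesis using that by (auto simp: sat_foldr_Imp)
qed

text \<open>A derivation of \<open>Bot\<close> uses finitely many hypotheses. One assignment
  satisfies those taken from \<Gamma>, and the sentences of the theory hold under every assignment
  into the universe, so soundness excludes the derivation.\<close>

lemma sat_imp_consistent_with_Th:
  fixes \<Gamma> :: "('r, 'v) fm set"
  assumes "\<And>F. finite F \<Longrightarrow> F \<subseteq> \<Gamma> \<Longrightarrow> \<exists>s. range s \<subseteq> univ M \<and> (\<forall>p\<in>F. sat M s [] p)"
  shows "consistent_with \<tau> (Th \<tau> M) \<Gamma>"
  unfolding consistent_with_def consistent_def
proof (intro notI, elim exE conjE)
  fix ps assume ps: "set ps \<subseteq> map_fm id (\<lambda>_. undefined) ` Th \<tau> M \<union> \<Gamma>"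
    and prov: "provable \<tau> (foldr Imp ps Bot)"
  obtain s where s: "range s \<subseteq> univ M" "\<forall>p\<in>set ps \<inter> \<Gamma>. sat M s [] p"
    using assms[of "set ps \<inter> \<Gamma>"] by auto
  have "sat M s [] p" if p: "p \<in> map_fm id (\<lambda>_. undefined) ` Th \<tau> M" for p
  proof -
    obtain q where q: "q \<in> Th \<tau> M" "p = map_fm id (\<lambda>_. undefined) q" using p by blast
    have "range (s \<circ> (\<lambda>_. undefined)) \<subseteq> univ M" using s(1) by auto
    then show ?thesis using q by (simp add: Th_def sat_map_fm)
  qed
  then have "\<forall>p\<in>set ps. sat M s [] p" using s ps by blast
  then show False using provable_sound[OF prov s(1)] by (simp add: sat_foldr_Imp)
qed

section \<open>Finite patterns\<close>

definition split_asg :: "nat \<Rightarrow> (nat \<Rightarrow> 'a) \<Rightarrow> (nat \<Rightarrow> 'a) \<Rightarrow> nat \<Rightarrow> 'a" where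
  "split_asg n a b v = (if v < n then a v else b (v - n))"

text \<open>A finite approximation of the pattern, realised by elements. The index \<eta> stays a
  total function with all values below \<open>N\<close>, although only rows below \<open>N\<close>
  are tested. Tuples are infinite sequences, of which a formula reads finitely many entries.\<close>

definition finite_pattern ::
    "('r, 'a) fo_struct \<Rightarrow> nat \<Rightarrow> (nat \<Rightarrow> ('r, nat) fm) \<Rightarrow> nat \<Rightarrow> bool" where
  "finite_pattern M n \<phi> N \<longleftrightarrow> (\<exists>(a :: (nat \<Rightarrow> nat) \<Rightarrow> nat \<Rightarrow> 'a) b.
     (\<forall>\<eta>. range (a \<eta>) \<subseteq> univ M) \<and> (\<forall>i j. range (b i j) \<subseteq> univ M) \<and>
     (\<forall>\<eta> i j. (\<forall>l. \<eta> l < N) \<longrightarrow> i < N \<longrightarrow> j < N \<longrightarrow>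
        (sat M (split_asg n (a \<eta>) (b i j)) [] (\<phi> i) \<longleftrightarrow> \<eta> i = j)))"

lemma sat_pat_inst:
  "sat M s [] (pat_inst n \<eta> i j p) \<longleftrightarrow> sat M (split_asg n (\<lambda>v. s (XVar \<eta> v)) (\<lambda>v. s (YVar i j v))) [] p"
proof -
  have "s \<circ> (\<lambda>v. if v < n then XVar \<eta> v else YVar i j (v - n)) =
      split_asg n (\<lambda>v. s (XVar \<eta> v)) (\<lambda>v. s (YVar i j v))"
    by (auto simp: split_asg_def)
  then show ?thesis unfolding pat_inst_def sat_map_fm by simp
qed

lemma sat_fm_if: "sat M s e (fm_if b p) \<longleftrightarrow> (sat M s e p \<longleftrightarrow> b)"
  by (simp add: fm_if_def)

text \<open>Rows from \<open>N\<close> on are not tested, so \<eta> may be replaced by its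
  truncation, which is 0 there. There are finitely many truncations with values below
  \<open>N\<close>, hence finitely many instances express the whole approximation.\<close>

lemma consistent_with_imp_finite_pattern:
  assumes wff: "\<And>i. wff \<tau> 0 (\<phi> i)"
    and con: "consistent_with \<tau> (Th \<tau> M) {fm_if (\<eta> i = j) (pat_inst n \<eta> i j (\<phi> i)) |i j \<eta>. True}"
  shows "finite_pattern M n \<phi> N"
proof -
  define trunc where "trunc \<eta> = (\<lambda>i. if i < N then \<eta> i else 0)" for \<eta> :: "nat \<Rightarrow> nat"
  define H where "H = {\<eta>. \<forall>i. (i \<in> {..<N} \<longrightarrow> \<eta> i \<in> {..<N}) \<and> (i \<notin> {..<N} \<longrightarrow> \<eta> i = (0 :: nat))}"
  have "finite H" unfolding H_def by (rule finite_set_of_finite_funs) auto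
  define F where "F = (\<lambda>(i, j, \<eta>). fm_if (\<eta> i = j) (pat_inst n \<eta> i j (\<phi> i))) ` ({..<N} \<times> {..<N} \<times> H)"
  have "finite F" using \<open>finite H\<close> by (simp add: F_def)
  then obtain ps where ps: "set ps = F" using finite_list by blast
  have psw: "\<forall>p\<in>set ps. wff \<tau> 0 p"
    unfolding ps F_def using wff by (auto simp: fm_if_def pat_inst_def)
  have psin: "set ps \<subseteq> {fm_if (\<eta> i = j) (pat_inst n \<eta> i j (\<phi> i)) |i j \<eta>. True}"
    unfolding ps F_def by auto
  obtain s where s: "range s \<subseteq> univ M" "\<forall>p\<in>F. sat M s [] p"
    using consistent_with_Th_imp_sat[OF con psin psw] unfolding ps by this
  define a where "a \<eta> v = s (XVar (trunc \<eta>) v)" for \<eta> v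
  define b where "b i j v = s (YVar i j v)" for i j v
  have "sat M (split_asg n (a \<eta>) (b i j)) [] (\<phi> i) \<longleftrightarrow> \<eta> i = j"
    if "\<forall>l. \<eta> l < N" "i < N" "j < N" for \<eta> i j
  proof -
    have "trunc \<eta> \<in> H" using that by (auto simp: trunc_def H_def)
    then have "fm_if (trunc \<eta> i = j) (pat_inst n (trunc \<eta>) i j (\<phi> i)) \<in> F"
      using that unfolding F_def by (intro rev_image_eqI[of "(i, j, trunc \<eta>)"]) auto
    then have "sat M s [] (fm_if (trunc \<eta> i = j) (pat_inst n (trunc \<eta>) i j (\<phi> i)))"
      using s(2) by blast
    then have "sat M (split_asg n (a \<eta>) (b i j)) [] (\<phi> i) \<longleftrightarrow> trunc \<eta> i = j"
      unfolding sat_fm_if sat_pat_inst a_def b_def .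
    then show ?thesis using that by (simp add: trunc_def)
  qed
  moreover have "range (a \<eta>) \<subseteq> univ M" "range (b i j) \<subseteq> univ M" for \<eta> i j
    using s(1) by (auto simp: a_def b_def)
  ultimately show ?thesis unfolding finite_pattern_def
    by (intro exI[of _ a] exI[of _ b] conjI allI impI) simp_all
qed

text \<open>A finite set of instances mentions finitely many rows, columns and functions, so the
  approximation of a sufficiently large size satisfies it.\<close>

lemma finite_patterns_imp_consistent_with:
  assumes pat: "\<And>N. finite_pattern M n \<phi> N"
  shows "consistent_with \<tau> (Th \<tau> M) {fm_if (\<eta> i = j) (pat_inst n \<eta> i j (\<phi> i)) |i j \<eta>. True}"
proof (rule sat_imp_consistent_with_Th)
  fix F
  assume F: "finite F" "F \<subseteq> {fm_if (\<eta> i = j) (pat_inst n \<eta> i j (\<phi> i)) |i j \<eta>. True}"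
  define g where "g = (\<lambda>(i, j, \<eta>). fm_if (\<eta> i = j) (pat_inst n \<eta> i j (\<phi> i)))"
  have "F \<subseteq> g ` UNIV"
    using F(2) unfolding g_def by (force simp: image_iff)
  then obtain C where C: "finite C" "F = g ` C" using F(1) by (meson finite_subset_image)
  \<comment> \<open>The inserted 0 covers the case of an empty \<open>C\<close>.\<close>
  define N where "N = Suc (Max (insert 0 ((\<lambda>(i, j, \<eta>). max i (max j (\<eta> i))) ` C)))"
  have bound: "i < N \<and> j < N \<and> \<eta> i < N" if "(i, j, \<eta>) \<in> C" for i j \<eta>
  proof -
    have "max i (max j (\<eta> i)) \<le> Max (insert 0 ((\<lambda>(i, j, \<eta>). max i (max j (\<eta> i))) ` C))"
      using C(1) that by (intro Max_ge) (auto intro: rev_image_eqI)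
    then show ?thesis by (auto simp: N_def)
  qed
  obtain a b where ab: "\<forall>\<eta>. range (a \<eta>) \<subseteq> univ M" "\<forall>i j. range (b i j) \<subseteq> univ M"
    and sat: "\<forall>\<eta> i j. (\<forall>l. \<eta> l < N) \<longrightarrow> i < N \<longrightarrow> j < N \<longrightarrow>
        (sat M (split_asg n (a \<eta>) (b i j)) [] (\<phi> i) \<longleftrightarrow> \<eta> i = j)"
    using pat[of N] unfolding finite_pattern_def by (elim exE conjE)
  \<comment> \<open>A function in \<open>C\<close> is known to be below \<open>N\<close> only at the
    row it is listed with. Resetting its large values to 0 makes it an admissible index and does not
    change the value at that row.\<close>
  define cap where "cap \<eta> = (\<lambda>i. if \<eta> i < N then \<eta> i else 0)" for \<eta> :: "nat \<Rightarrow> nat"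
  define s where "s x = (case x of XVar \<eta> v \<Rightarrow> a (cap \<eta>) v | YVar i j v \<Rightarrow> b i j v)" for x
  have "s x \<in> univ M" for x
    using ab(1)[rule_format, THEN range_subsetD] ab(2)[rule_format, THEN range_subsetD]
    by (cases x) (auto simp: s_def)
  then have "range s \<subseteq> univ M" by blast
  moreover have "sat M s [] (g c)" if "c \<in> C" for c
  proof -
    obtain i j \<eta> where c: "c = (i, j, \<eta>)" by (cases c) auto
    have "sat M (split_asg n (a (cap \<eta>)) (b i j)) [] (\<phi> i) \<longleftrightarrow> cap \<eta> i = j"
      using bound that c by (intro sat[rule_format]) (auto simp: cap_def N_def)
    then show ?thesis using bound that c by (simp add: g_def sat_fm_if sat_pat_inst s_def cap_def)
  qed
  ultimately show "\<exists>s. range s \<subseteq> univ M \<and> (\<forall>p\<in>F. sat M s [] p)" using C by blast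
qed

text \<open>From here on provability disappears: only satisfaction of finite patterns in the
  structure matters.\<close>

lemma strongly_dependent1_Th_iff:
  "strongly_dependent1 \<tau> (Th \<tau> M) \<longleftrightarrow>
     \<not> (\<exists>n k \<phi>. (\<forall>i. wff \<tau> 0 (\<phi> i) \<and> fm_frees (\<phi> i) \<subseteq> {..<n + k i}) \<and>
          (\<forall>N. finite_pattern M n \<phi> N))"
  unfolding strongly_dependent1_def
proof (intro arg_cong[where f = Not] ex_cong1 conj_cong refl iffI allI)
  fix n N and k :: "nat \<Rightarrow> nat" and \<phi>
  assume wff: "\<forall>i. wff \<tau> 0 (\<phi> i) \<and> fm_frees (\<phi> i) \<subseteq> {..<n + k i}"
    and con: "consistent_with \<tau> (Th \<tau> M) {fm_if (\<eta> i = j) (pat_inst n \<eta> i j (\<phi> i)) |i j \<eta>. True}"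
  show "finite_pattern M n \<phi> N"
    by (rule consistent_with_imp_finite_pattern[OF _ con]) (use wff in blast)
next
  fix n and \<phi> :: "nat \<Rightarrow> ('a, nat) fm"
  assume "\<forall>N. finite_pattern M n \<phi> N"
  then show "consistent_with \<tau> (Th \<tau> M) {fm_if (\<eta> i = j) (pat_inst n \<eta> i j (\<phi> i)) |i j \<eta>. True}"
    by (intro finite_patterns_imp_consistent_with) blast
qed

section \<open>Ramsey and compactness principles\<close>

lemma ramsey_finite_colours:
  assumes "finite C"
  shows "\<exists>R :: nat. \<forall>f \<in> nsets {..<R} r \<rightarrow> C.
    \<exists>H c. H \<in> nsets {..<R} K \<and> f ` nsets H r \<subseteq> {c}"
proof -
  \<comment> \<open>The library form numbers the colours by an initial segment of the naturals, and
    \<open>h\<close> translates.\<close>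
  obtain h where h: "bij_betw h C {..<card C}"
    using assms bij_betw_iff_card by (metis card_lessThan finite_lessThan)
  obtain R :: nat where R: "partn_lst {..<R} (replicate (card C) K) r" using ramsey_full by blast
  show ?thesis
  proof (intro exI[of _ R] ballI)
    fix f assume f: "f \<in> nsets {..<R} r \<rightarrow> C"
    have "h \<circ> f \<in> nsets {..<R} r \<rightarrow> {..<card C}"
      using f bij_betw_apply[OF h] by (auto simp: Pi_iff)
    then obtain i H where i: "i < card C"
      and H: "H \<in> nsets {..<R} (replicate (card C) K ! i)" "(h \<circ> f) ` nsets H r \<subseteq> {i}"
      using partn_lstE[OF R] by (metis length_replicate)
    have "f e = inv_into C h i" if "e \<in> nsets H r" for e
    proof -
      have "e \<in> nsets {..<R} r" using that H(1) by (auto simp: nsets_def)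
      then have "f e \<in> C" using f by auto
      moreover have "h (f e) = i" using H(2) that by auto
      ultimately show ?thesis using h by (auto simp: bij_betw_def)
    qed
    then show "\<exists>H c. H \<in> nsets {..<R} K \<and> f ` nsets H r \<subseteq> {c}" using H(1) i by auto
  qed
qed

text \<open>Induction on the number of coordinates. A set in the last coordinate is coloured by the
  whole colouring that it induces on the product of the others. These are finitely many colours, so
  on some \<open>H\<close> the induced colouring is the same for all \<open>r\<close>-subsets, and
  the induction hypothesis applies to it.\<close>

lemma product_ramsey:
  fixes m K r :: nat
  assumes "finite C"
  shows "\<exists>R :: nat. \<forall>f \<in> (\<Pi>\<^sub>E i\<in>{..<m}. nsets {..<R} r) \<rightarrow> C.
    \<exists>J c. (\<forall>i<m. J i \<in> nsets {..<R} K) \<and> (\<forall>e \<in> \<Pi>\<^sub>E i\<in>{..<m}. nsets (J i) r. f e = c)"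
proof (induction m)
  case 0
  then show ?case by auto
next
  case (Suc m)
  then obtain R :: nat where R: "\<forall>f \<in> (\<Pi>\<^sub>E i\<in>{..<m}. nsets {..<R} r) \<rightarrow> C.
    \<exists>J c. (\<forall>i<m. J i \<in> nsets {..<R} K) \<and> (\<forall>e \<in> \<Pi>\<^sub>E i\<in>{..<m}. nsets (J i) r. f e = c)"
    by (elim exE)
  let ?B = "\<lambda>R. \<Pi>\<^sub>E i\<in>{..<m}. nsets {..<R :: nat} r"
  have finB: "finite (?B R)" by (intro finite_PiE) (auto simp: finite_imp_finite_nsets)
  then have "finite (\<Pi>\<^sub>E e\<in>?B R. C)" using assms by (rule finite_PiE)
  from ramsey_finite_colours[OF this, of r K] obtain R' :: nat
    where R': "\<forall>f \<in> nsets {..<R'} r \<rightarrow> (\<Pi>\<^sub>E e\<in>?B R. C).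
      \<exists>H c. H \<in> nsets {..<R'} K \<and> f ` nsets H r \<subseteq> {c}"
    by (elim exE)
  let ?R = "max R R'"
  have sub: "nsets {..<R} q \<subseteq> nsets {..<?R} q" "nsets {..<R'} q \<subseteq> nsets {..<?R} q" for q
    by (auto simp: nsets_def)
  show ?case
  proof (intro exI[of _ ?R] ballI)
    fix f assume f: "f \<in> (\<Pi>\<^sub>E i\<in>{..<Suc m}. nsets {..<?R} r) \<rightarrow> C"
    have fC: "f (e(m := E)) \<in> C" if "e \<in> ?B R" "E \<in> nsets {..<R'} r" for e E
    proof -
      have "e(m := E) \<in> (\<Pi>\<^sub>E i\<in>{..<Suc m}. nsets {..<?R} r)"
        using that sub[of r] by (auto simp: PiE_iff extensional_def less_Suc_eq)
      then show ?thesis using f by blast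
    qed
    define g where "g E = restrict (\<lambda>e. f (e(m := E))) (?B R)" for E
    have "g \<in> nsets {..<R'} r \<rightarrow> (\<Pi>\<^sub>E e\<in>?B R. C)" using fC by (auto simp: g_def)
    with R' have "\<exists>H c. H \<in> nsets {..<R'} K \<and> g ` nsets H r \<subseteq> {c}" by (rule bspec)
    then obtain H c where H: "H \<in> nsets {..<R'} K" "g ` nsets H r \<subseteq> {c}" by (elim exE conjE)
    have Hsub: "nsets H r \<subseteq> nsets {..<R'} r" using H(1) by (auto simp: nsets_def)
    show "\<exists>J c. (\<forall>i<Suc m. J i \<in> nsets {..<?R} K) \<and> (\<forall>e \<in> \<Pi>\<^sub>E i\<in>{..<Suc m}. nsets (J i) r. f e = c)"
    \<comment> \<open>If \<open>H\<close> has no \<open>r\<close>-subset, the product is empty and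
      the colour condition is vacuous. Otherwise one fixed \<open>E\<close> represents all
      \<open>r\<close>-subsets of \<open>H\<close>.\<close>
    proof (cases "nsets H r = {}")
      case True
      have "(\<Pi>\<^sub>E i\<in>{..<Suc m}. nsets H r) = {}" using True by (auto simp: PiE_eq_empty_iff)
      then show ?thesis using H(1) sub(2)[of K] by (intro exI[of _ "\<lambda>_. H"]) auto
    next
      case False
      then obtain E where E: "E \<in> nsets H r" by blast
      have "(\<lambda>e. f (e(m := E))) \<in> ?B R \<rightarrow> C" using fC E Hsub by blast
      from bspec[OF R this] obtain J d where J: "\<forall>i<m. J i \<in> nsets {..<R} K"
        "\<forall>e \<in> \<Pi>\<^sub>E i\<in>{..<m}. nsets (J i) r. f (e(m := E)) = d"
        by (elim exE conjE)
      have "f e = d" if e: "e \<in> (\<Pi>\<^sub>E i\<in>{..<Suc m}. nsets ((J(m := H)) i) r)" for e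
      proof -
        define e' where "e' = restrict e {..<m}"
        have e': "e' \<in> (\<Pi>\<^sub>E i\<in>{..<m}. nsets (J i) r)"
          using e by (auto simp: e'_def PiE_iff less_Suc_eq split: if_splits)
        have "nsets (J i) r \<subseteq> nsets {..<R} r" if "i < m" for i
          using J(1) that by (fastforce simp: nsets_def)
        then have eB: "e' \<in> ?B R" using e' by (auto simp: PiE_iff)
        have em: "e m \<in> nsets H r" using PiE_mem[OF e, of m] by simp
        have "e = e'(m := e m)"
          using e by (intro ext) (auto simp: e'_def PiE_iff extensional_def)
        then have "f e = g (e m) e'" using eB by (simp add: g_def)
        also have "\<dots> = g E e'" using H(2) em E by (metis image_subset_iff singletonD)
        also have "\<dots> = f (e'(m := E))" using eB by (simp add: g_def)
        also have "\<dots> = d" by (rule J(2)[rule_format, OF e'])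
        finally show ?thesis .
      qed
      moreover have "\<forall>i<Suc m. (J(m := H)) i \<in> nsets {..<?R} K"
        using J(1) H(1) sub[of K] by (auto simp: less_Suc_eq)
      ultimately show ?thesis by blast
    qed
  qed
qed

section \<open>Koenig's lemma for binary choices\<close>

lemma koenig_bool:
  fixes P :: "nat \<Rightarrow> (nat \<Rightarrow> bool) \<Rightarrow> bool"
  assumes ex: "\<And>N. \<exists>d. P N d"
    and mono: "\<And>N d. P (Suc N) d \<Longrightarrow> P N d"
    and local: "\<And>N d d'. P N d \<Longrightarrow> (\<And>i. i < N \<Longrightarrow> d i = d' i) \<Longrightarrow> P N d'"
  shows "\<exists>d. \<forall>N. P N d"
proof -
  have le: "P N d" if "P N' d" "N \<le> N'" for N N' d
    using that(2,1) by (induction rule: dec_induct) (auto intro: mono)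
  \<comment> \<open>A finite bit string is live if solutions of every size extend it. Live strings
    always have a live successor, and since \<open>P N\<close> looks at the first \<open>N\<close>
    bits only, an infinite branch of live strings is a solution of every size.\<close>
  define live where "live bs \<longleftrightarrow> (\<forall>N. \<exists>d. P N d \<and> (\<forall>i<length bs. d i = bs ! i))" for bs
  have "live []" using ex by (simp add: live_def)
  have step: "\<exists>b. live (bs @ [b])" if "live bs" for bs
  proof (rule ccontr)
    assume "\<not> ?thesis"
    then have "\<not> live (bs @ [True])" "\<not> live (bs @ [False])" by auto
    then obtain N N' where
      N: "\<And>d. P N d \<Longrightarrow> \<not> (\<forall>i<length (bs @ [True]). d i = (bs @ [True]) ! i)" and
      N': "\<And>d. P N' d \<Longrightarrow> \<not> (\<forall>i<length (bs @ [False]). d i = (bs @ [False]) ! i)"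
      unfolding live_def by blast
    \<comment> \<open>If one successor fails at \<open>N\<close> and the other at \<open>N'\<close>,
      a solution of the larger size continues \<open>bs\<close> by one of the two bits and, by
      monotonicity, contradicts that failure.\<close>
    obtain d where d: "P (max N N') d" "\<forall>i<length bs. d i = bs ! i"
      using \<open>live bs\<close> unfolding live_def by blast
    have "P N d" "P N' d" using d(1) le by auto
    then show False
      using N[of d] N'[of d] d(2) by (cases "d (length bs)") (auto simp: nth_append less_Suc_eq)
  qed
  define ext where "ext bs = bs @ [SOME b. live (bs @ [b])]" for bs
  define pre where "pre m = (ext ^^ m) []" for m
  have live: "live (pre m)" for m
    by (induction m) (use \<open>live []\<close> step in \<open>auto simp: pre_def ext_def intro: someI_ex\<close>)
  have len: "length (pre m) = m" for m by (induction m) (auto simp: pre_def ext_def)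
  have nth: "pre m ! i = pre (Suc i) ! i" if "i < m" for i m
    using that
  proof (induction m)
    case (Suc m)
    show ?case
    proof (cases "i = m")
      case False
      then have "i < m" using Suc.prems by simp
      moreover have "pre (Suc m) ! i = pre m ! i" if "i < m"
        using len[of m] that by (simp add: pre_def ext_def nth_append)
      ultimately show ?thesis using Suc.IH by (simp only:)
    qed (simp only:)
  qed simp
  show ?thesis
  proof (intro exI allI)
    fix N
    obtain d where d: "P N d" "\<forall>i<N. d i = pre N ! i"
      using live[of N] len[of N] unfolding live_def by auto
    have "d i = pre (Suc i) ! i" if "i < N" for i using d(2) that nth[OF that] by simp
    then show "P N (\<lambda>i. pre (Suc i) ! i)" by (rule local[OF d(1)])
  qed
qed

section \<open>Arrays whose entries depend only on the order of the indices\<close>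

lemma sorted_list_of_set_triple:
  "x < y \<Longrightarrow> y < z \<Longrightarrow> sorted_list_of_set {x, y, z :: nat} = [x, y, z]"
  using sorted_list_of_set.idem_if_sorted_distinct[of "[x, y, z]"] by simp

text \<open>Product Ramsey for triples: the middle elements of the triples spell out \<eta>, and the
  outer elements of the \<open>i\<close>-th triple are columns below and above
  \<open>\<eta> i\<close>. The bounds on \<open>\<eta> l\<close> guarantee that every middle element
  has neighbours on both sides, so that it can be completed to a triple.\<close>

lemma homogeneous_array:
  fixes D :: "nat \<Rightarrow> 'c set" and N K :: nat
  assumes fin: "\<And>i. finite (D i)"
  shows "\<exists>R. \<forall>F :: nat \<Rightarrow> (nat \<Rightarrow> nat) \<Rightarrow> nat \<Rightarrow> 'c. (\<forall>i \<eta> j. F i \<eta> j \<in> D i) \<longrightarrow>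
    (\<exists>h A B C. (\<forall>i<N. \<forall>j<K. h i j < R) \<and> (\<forall>i<N. \<forall>j j'. j < j' \<longrightarrow> j' < K \<longrightarrow> h i j < h i j') \<and>
      (\<forall>\<eta> i j. (\<forall>l<N. 0 < \<eta> l \<and> Suc (\<eta> l) < K) \<longrightarrow> i < N \<longrightarrow> j < K \<longrightarrow>
         F i (\<lambda>l. if l < N then h l (\<eta> l) else 0) (h i j) =
           (if j < \<eta> i then A i else if j = \<eta> i then B i else C i)))"
proof -
  define Q where "Q = (\<Pi>\<^sub>E i\<in>{..<N}. D i \<times> D i \<times> D i)"
  have "finite Q" unfolding Q_def using fin by (intro finite_PiE) auto
  from product_ramsey[OF this, of N 3 K] obtain R :: nat
    where R: "\<forall>f \<in> (\<Pi>\<^sub>E i\<in>{..<N}. nsets {..<R} 3) \<rightarrow> Q.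
      \<exists>J c. (\<forall>i<N. J i \<in> nsets {..<R} K) \<and> (\<forall>e \<in> \<Pi>\<^sub>E i\<in>{..<N}. nsets (J i) 3. f e = c)"
    by (elim exE)
  show ?thesis
  proof (intro exI[of _ R] allI impI)
    fix F :: "nat \<Rightarrow> (nat \<Rightarrow> nat) \<Rightarrow> nat \<Rightarrow> 'c"
    assume F: "\<forall>i \<eta> j. F i \<eta> j \<in> D i"
    \<comment> \<open>The colour of a choice of triples records, for every row, the values of
      \<open>F\<close> at the lowest, middle and highest element of that row's triple.\<close>
    define mid where "mid e = (\<lambda>l. if l < N then sorted_list_of_set (e l) ! 1 else 0)" for e :: "nat \<Rightarrow> nat set"
    define f where "f e = (\<lambda>i\<in>{..<N}. (F i (mid e) (sorted_list_of_set (e i) ! 0),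
      F i (mid e) (sorted_list_of_set (e i) ! 1), F i (mid e) (sorted_list_of_set (e i) ! 2)))" for e
    have "f \<in> (\<Pi>\<^sub>E i\<in>{..<N}. nsets {..<R} 3) \<rightarrow> Q" using F by (auto simp: f_def Q_def)
    from bspec[OF R this] obtain J c where J: "\<forall>i<N. J i \<in> nsets {..<R} K"
      and c: "\<forall>e \<in> \<Pi>\<^sub>E i\<in>{..<N}. nsets (J i) 3. f e = c"
      by (elim exE conjE)
    define h where "h i j = sorted_list_of_set (J i) ! j" for i j
    have fJ: "finite (J i)" "card (J i) = K" "J i \<subseteq> {..<R}" if "i < N" for i
      using J that by (auto simp: nsets_def)
    have hJ: "h i j \<in> J i" if "i < N" "j < K" for i j
      using fJ[OF that(1)] that(2) nth_mem[of j "sorted_list_of_set (J i)"] by (simp add: h_def)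
    have hmono: "h i j < h i j'" if "i < N" "j < j'" "j' < K" for i j j'
      using fJ[OF that(1)] that(2,3) sorted_wrt_nth_less[OF strict_sorted_list_of_set[of "J i"], of j j']
      by (simp add: h_def)
    have key: "c i = (F i (\<lambda>l. if l < N then h l (\<eta> l) else 0) (h i j),
        F i (\<lambda>l. if l < N then h l (\<eta> l) else 0) (h i (\<eta> i)),
        F i (\<lambda>l. if l < N then h l (\<eta> l) else 0) (h i j'))"
      if \<eta>: "\<forall>l<N. 0 < \<eta> l \<and> Suc (\<eta> l) < K" and i: "i < N" and j: "j < \<eta> i" "\<eta> i < j'" "j' < K"
      for \<eta> i j j'
    proof -
      \<comment> \<open>Only the triple of row \<open>i\<close> has prescribed outer elements. In
        the other rows any will do, and 0 and the successor are always available.\<close>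
      define lo hi where "lo l = (if l = i then j else 0)"
        and "hi l = (if l = i then j' else Suc (\<eta> l))" for l
      have lohi: "lo l < \<eta> l" "\<eta> l < hi l" "hi l < K" if "l < N" for l
        using \<eta> j that by (auto simp: lo_def hi_def)
      define e where "e = (\<lambda>l\<in>{..<N}. {h l (lo l), h l (\<eta> l), h l (hi l)})"
      have ord: "h l (lo l) < h l (\<eta> l)" "h l (\<eta> l) < h l (hi l)" if "l < N" for l
        using lohi[OF that] that by (auto intro!: hmono)
      have sl: "sorted_list_of_set (e l) = [h l (lo l), h l (\<eta> l), h l (hi l)]" if "l < N" for l
        using sorted_list_of_set_triple[OF ord[OF that]] that by (simp add: e_def)
      have "e \<in> (\<Pi>\<^sub>E i\<in>{..<N}. nsets (J i) 3)"
      proof (unfold e_def, rule restrict_PiE_iff[THEN iffD2], intro ballI)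
        fix l assume "l \<in> {..<N}"
        then have l: "l < N" by simp
        have "h l (lo l) \<in> J l" "h l (\<eta> l) \<in> J l" "h l (hi l) \<in> J l"
          using lohi[OF l] l by (auto intro!: hJ)
        moreover have "card {h l (lo l), h l (\<eta> l), h l (hi l)} = 3"
          using ord[OF l] by auto
        ultimately show "{h l (lo l), h l (\<eta> l), h l (hi l)} \<in> nsets (J l) 3"
          by (simp add: nsets_def)
      qed
      then have "c i = f e i" using c by simp
      moreover have "mid e = (\<lambda>l. if l < N then h l (\<eta> l) else 0)"
        by (auto simp: mid_def sl)
      ultimately show ?thesis using i by (simp add: f_def sl lo_def hi_def)
    qed
    have "F i (\<lambda>l. if l < N then h l (\<eta> l) else 0) (h i j) =
        (if j < \<eta> i then fst (c i) else if j = \<eta> i then fst (snd (c i)) else snd (snd (c i)))"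
      if \<eta>: "\<forall>l<N. 0 < \<eta> l \<and> Suc (\<eta> l) < K" and i: "i < N" and j: "j < K" for \<eta> i j
    proof -
      have \<eta>i: "0 < \<eta> i" "Suc (\<eta> i) < K" using \<eta> i by auto
      \<comment> \<open>The column \<open>j\<close> is one element of the triple in row
        \<open>i\<close>; missing outer elements are filled in by 0 and
        \<open>Suc (\<eta> i)\<close>.\<close>
      consider "j < \<eta> i" | "j = \<eta> i" | "\<eta> i < j" by linarith
      then show ?thesis
      proof cases
        case 1
        then show ?thesis using key[OF \<eta> i, of j "Suc (\<eta> i)"] \<eta>i by simp
      next
        case 2
        then show ?thesis using key[OF \<eta> i, of 0 "Suc (\<eta> i)"] \<eta>i by simp
      next
        case 3
        then show ?thesis using key[OF \<eta> i, of 0 j] \<eta>i j by simp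
      qed
    qed
    moreover have "\<forall>i<N. \<forall>j<K. h i j < R" using hJ fJ(3) by blast
    ultimately show "\<exists>h A B C. (\<forall>i<N. \<forall>j<K. h i j < R) \<and>
      (\<forall>i<N. \<forall>j j'. j < j' \<longrightarrow> j' < K \<longrightarrow> h i j < h i j') \<and>
      (\<forall>\<eta> i j. (\<forall>l<N. 0 < \<eta> l \<and> Suc (\<eta> l) < K) \<longrightarrow> i < N \<longrightarrow> j < K \<longrightarrow>
         F i (\<lambda>l. if l < N then h l (\<eta> l) else 0) (h i j) =
           (if j < \<eta> i then A i else if j = \<eta> i then B i else C i))"
      using hmono
      by (intro exI[of _ h] exI[of _ "\<lambda>i. fst (c i)"] exI[of _ "\<lambda>i. fst (snd (c i))"]
          exI[of _ "\<lambda>i. snd (snd (c i))"]) simp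
  qed
qed

section \<open>Formulas in a sum of structures\<close>

text \<open>Components outside \<open>U\<close> are sent to arbitrary dummy elements of \<open>U\<close>, so that the variables need
  not be divided between the two summands.\<close>

definition proj_to :: "'a set \<Rightarrow> 'a \<Rightarrow> 'a \<Rightarrow> bool" where
  "proj_to U x y \<longleftrightarrow> y \<in> U \<and> (x \<in> U \<longrightarrow> y = x)"

definition projections ::
    "'a set \<Rightarrow> 'a set \<Rightarrow> ('v \<Rightarrow> 'a) \<Rightarrow> 'a list \<Rightarrow> ('v \<Rightarrow> 'a) \<Rightarrow> 'a list \<Rightarrow> ('v \<Rightarrow> 'a) \<Rightarrow> 'a list \<Rightarrow> bool"
where
  "projections U\<^sub>1 U\<^sub>2 s e s\<^sub>1 e\<^sub>1 s\<^sub>2 e\<^sub>2 \<longleftrightarrow>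
     range s \<subseteq> U\<^sub>1 \<union> U\<^sub>2 \<and> set e \<subseteq> U\<^sub>1 \<union> U\<^sub>2 \<and>
     (\<forall>v. proj_to U\<^sub>1 (s v) (s\<^sub>1 v)) \<and> list_all2 (proj_to U\<^sub>1) e e\<^sub>1 \<and>
     (\<forall>v. proj_to U\<^sub>2 (s v) (s\<^sub>2 v)) \<and> list_all2 (proj_to U\<^sub>2) e e\<^sub>2"

lemma tm_val_projections:
  assumes "projections U\<^sub>1 U\<^sub>2 s e s\<^sub>1 e\<^sub>1 s\<^sub>2 e\<^sub>2" and "tm_ok (length e) t"
  shows "tm_val s e t \<in> U\<^sub>1 \<union> U\<^sub>2"
    and "proj_to U\<^sub>1 (tm_val s e t) (tm_val s\<^sub>1 e\<^sub>1 t)"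
    and "proj_to U\<^sub>2 (tm_val s e t) (tm_val s\<^sub>2 e\<^sub>2 t)"
proof -
  have "tm_val s e t \<in> U\<^sub>1 \<union> U\<^sub>2 \<and> proj_to U\<^sub>1 (tm_val s e t) (tm_val s\<^sub>1 e\<^sub>1 t) \<and>
    proj_to U\<^sub>2 (tm_val s e t) (tm_val s\<^sub>2 e\<^sub>2 t)"
  proof (cases t)
    case (Fr v)
    then show ?thesis using assms(1) by (auto simp: projections_def)
  next
    case (Bd i)
    then have "e ! i \<in> set e" using assms(2) by simp
    then show ?thesis
      using assms Bd by (auto simp: projections_def list_all2_conv_all_nth simp del: nth_mem)
  qed
  then show "tm_val s e t \<in> U\<^sub>1 \<union> U\<^sub>2" "proj_to U\<^sub>1 (tm_val s e t) (tm_val s\<^sub>1 e\<^sub>1 t)"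
    "proj_to U\<^sub>2 (tm_val s e t) (tm_val s\<^sub>2 e\<^sub>2 t)" by blast+
qed

text \<open>Relations of a structure contain only tuples from its universe, and on the universe a
  projection is the identity.\<close>

lemma map_tm_val_projection_in_rel:
  assumes "is_structure \<tau> M" and "\<tau> S = Some m"
    and "\<And>t. t \<in> set ts \<Longrightarrow> proj_to (univ M) (f t) (g t)"
  shows "map f ts \<in> rel M S \<longleftrightarrow> (\<forall>t\<in>set ts. f t \<in> univ M) \<and> map g ts \<in> rel M S"
proof -
  have "\<forall>t\<in>set ts. f t \<in> univ M" if "map f ts \<in> rel M S"
    using assms(1,2) that unfolding is_structure_def by fastforce
  moreover have "map f ts = map g ts" if "\<forall>t\<in>set ts. f t \<in> univ M"
    using assms(3) that by (auto simp: proj_to_def)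
  ultimately show ?thesis by metis
qed

section \<open>Finite types and their realisation\<close>

lemma type_formula_exists:
  fixes \<Psi> :: "('r, 'v) fm set"
  assumes "finite \<Psi>" and "\<forall>\<psi>\<in>\<Psi>. wff \<tau> d \<psi> \<and> fm_frees \<psi> \<subseteq> V"
  shows "\<exists>q. wff \<tau> d q \<and> fm_frees q \<subseteq> V \<and>
    (\<forall>(M :: ('r, 'a) fo_struct) s e. sat M s e q \<longleftrightarrow> {\<psi>\<in>\<Psi>. sat M s e \<psi>} = X \<inter> \<Psi>)"
  using assms
proof (induction \<Psi> rule: finite_induct)
  case empty
  show ?case by (rule exI[of _ "Neg Bot"]) simp
next
  case (insert \<psi> \<Psi>)
  then obtain q where q: "wff \<tau> d q" "fm_frees q \<subseteq> V"
    "\<And>(M :: ('r, 'a) fo_struct) s e. sat M s e q \<longleftrightarrow> {\<psi>\<in>\<Psi>. sat M s e \<psi>} = X \<inter> \<Psi>"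
    by force
  \<comment> \<open>The formula is a conjunction of literals, one for each member of \<Psi>, with
    signs prescribed by \<open>X\<close>.\<close>
  let ?l = "if \<psi> \<in> X then \<psi> else Neg \<psi>"
  have "sat M s e (Neg (Imp q (Neg ?l))) \<longleftrightarrow>
      {\<psi>'\<in>insert \<psi> \<Psi>. sat M s e \<psi>'} = X \<inter> insert \<psi> \<Psi>" for M :: "('r, 'a) fo_struct" and s e
    using insert.hyps(2) by (auto simp: q(3) set_eq_iff)
  moreover have "wff \<tau> d (Neg (Imp q (Neg ?l)))" "fm_frees (Neg (Imp q (Neg ?l))) \<subseteq> V"
    using q(1,2) insert.prems by auto
  ultimately show ?case by blast
qed

text \<open>One step of back-and-forth: the formulas of \<Phi> say, for each of the finitely many
  \<Psi>-types, that no element realises it. Agreement on \<Phi> therefore means that the same types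
  are realised.\<close>

lemma type_realization_formulas_exist:
  fixes \<Psi> :: "('r, 'v) fm set"
  assumes fin: "finite \<Psi>" and wff: "\<forall>\<psi>\<in>\<Psi>. wff \<tau> (Suc d) \<psi> \<and> fm_frees \<psi> \<subseteq> V"
  shows "\<exists>\<Phi>. finite \<Phi> \<and> (\<forall>\<phi>\<in>\<Phi>. wff \<tau> d \<phi> \<and> fm_frees \<phi> \<subseteq> V) \<and>
    (\<forall>(M :: ('r, 'a) fo_struct) s e s' e'. (\<forall>\<phi>\<in>\<Phi>. sat M s e \<phi> \<longleftrightarrow> sat M s' e' \<phi>) \<longrightarrow>
      (\<forall>x\<in>univ M. \<exists>y\<in>univ M. \<forall>\<psi>\<in>\<Psi>. sat M s (x # e) \<psi> \<longleftrightarrow> sat M s' (y # e') \<psi>))"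
proof -
  have "\<forall>X. \<exists>q. wff \<tau> (Suc d) q \<and> fm_frees q \<subseteq> V \<and>
    (\<forall>(M :: ('r, 'a) fo_struct) s e. sat M s e q \<longleftrightarrow> {\<psi>\<in>\<Psi>. sat M s e \<psi>} = X \<inter> \<Psi>)"
    using type_formula_exists[OF assms] by blast
  then obtain T where T: "\<And>X. wff \<tau> (Suc d) (T X)" "\<And>X. fm_frees (T X) \<subseteq> V"
    "\<And>X (M :: ('r, 'a) fo_struct) s e. sat M s e (T X) \<longleftrightarrow> {\<psi>\<in>\<Psi>. sat M s e \<psi>} = X \<inter> \<Psi>"
    by metis
  let ?\<Phi> = "(\<lambda>X. All (Neg (T X))) ` Pow \<Psi>"
  show ?thesis
  proof (intro exI[of _ ?\<Phi>] conjI ballI allI impI)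
    show "finite ?\<Phi>" using fin by simp
    show "wff \<tau> d \<phi>" "fm_frees \<phi> \<subseteq> V" if "\<phi> \<in> ?\<Phi>" for \<phi>
      using that T(1) T(2)[THEN subsetD] by auto
    fix M :: "('r, 'a) fo_struct" and s e s' e' x
    assume agree: "\<forall>\<phi>\<in>?\<Phi>. sat M s e \<phi> \<longleftrightarrow> sat M s' e' \<phi>" and x: "x \<in> univ M"
    let ?X = "{\<psi>\<in>\<Psi>. sat M s (x # e) \<psi>}"
    have "sat M s (x # e) (T ?X)" unfolding T(3) by auto
    then have "\<not> sat M s e (All (Neg (T ?X)))" using x by auto
    moreover have "All (Neg (T ?X)) \<in> ?\<Phi>" by blast
    ultimately have "\<not> sat M s' e' (All (Neg (T ?X)))" using agree by blast
    then obtain y where y: "y \<in> univ M" "sat M s' (y # e') (T ?X)" by auto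
    then have "\<forall>\<psi>\<in>\<Psi>. sat M s (x # e) \<psi> \<longleftrightarrow> sat M s' (y # e') \<psi>" unfolding T(3) by blast
    then show "\<exists>y\<in>univ M. \<forall>\<psi>\<in>\<Psi>. sat M s (x # e) \<psi> \<longleftrightarrow> sat M s' (y # e') \<psi>" using y by blast
  qed
qed

section \<open>Truth in a sum from finite types in the summands\<close>

definition determines ::
  "('r, 'a) fo_struct \<Rightarrow> ('r, 'a) fo_struct \<Rightarrow> nat \<Rightarrow> ('r, 'v) fm set \<Rightarrow> ('r lr_sym, 'v) fm \<Rightarrow> bool"
where
  "determines M\<^sub>1 M\<^sub>2 d \<Psi> p \<longleftrightarrow> (\<forall>s e s\<^sub>1 e\<^sub>1 s\<^sub>2 e\<^sub>2 s' e' s\<^sub>1' e\<^sub>1' s\<^sub>2' e\<^sub>2'.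
     projections (univ M\<^sub>1) (univ M\<^sub>2) s e s\<^sub>1 e\<^sub>1 s\<^sub>2 e\<^sub>2 \<longrightarrow>
     projections (univ M\<^sub>1) (univ M\<^sub>2) s' e' s\<^sub>1' e\<^sub>1' s\<^sub>2' e\<^sub>2' \<longrightarrow>
     length e = d \<longrightarrow>
     (\<forall>v\<in>fm_frees p. s v \<in> univ M\<^sub>1 \<longleftrightarrow> s' v \<in> univ M\<^sub>1) \<longrightarrow>
     list_all2 (\<lambda>x y. x \<in> univ M\<^sub>1 \<longleftrightarrow> y \<in> univ M\<^sub>1) e e' \<longrightarrow>
     (\<forall>\<psi>\<in>\<Psi>. sat M\<^sub>1 s\<^sub>1 e\<^sub>1 \<psi> \<longleftrightarrow> sat M\<^sub>1 s\<^sub>1' e\<^sub>1' \<psi>) \<longrightarrow>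
     (\<forall>\<psi>\<in>\<Psi>. sat M\<^sub>2 s\<^sub>2 e\<^sub>2 \<psi> \<longleftrightarrow> sat M\<^sub>2 s\<^sub>2' e\<^sub>2' \<psi>) \<longrightarrow>
     sat (M\<^sub>1 \<oplus> M\<^sub>2) s e p \<longrightarrow> sat (M\<^sub>1 \<oplus> M\<^sub>2) s' e' p)"

text \<open>The conditions on the two assignments are symmetric, so the implication in the
  definition of \<open>determines\<close> can be applied in both directions.\<close>

lemma determinesD:
  assumes "determines M\<^sub>1 M\<^sub>2 d \<Psi> p"
    and "projections (univ M\<^sub>1) (univ M\<^sub>2) s e s\<^sub>1 e\<^sub>1 s\<^sub>2 e\<^sub>2"
    and "projections (univ M\<^sub>1) (univ M\<^sub>2) s' e' s\<^sub>1' e\<^sub>1' s\<^sub>2' e\<^sub>2'"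
    and "length e = d"
    and "\<forall>v\<in>fm_frees p. s v \<in> univ M\<^sub>1 \<longleftrightarrow> s' v \<in> univ M\<^sub>1"
    and "list_all2 (\<lambda>x y. x \<in> univ M\<^sub>1 \<longleftrightarrow> y \<in> univ M\<^sub>1) e e'"
    and "\<forall>\<psi>\<in>\<Psi>. sat M\<^sub>1 s\<^sub>1 e\<^sub>1 \<psi> \<longleftrightarrow> sat M\<^sub>1 s\<^sub>1' e\<^sub>1' \<psi>"
    and "\<forall>\<psi>\<in>\<Psi>. sat M\<^sub>2 s\<^sub>2 e\<^sub>2 \<psi> \<longleftrightarrow> sat M\<^sub>2 s\<^sub>2' e\<^sub>2' \<psi>"
  shows "sat (M\<^sub>1 \<oplus> M\<^sub>2) s e p \<longleftrightarrow> sat (M\<^sub>1 \<oplus> M\<^sub>2) s' e' p"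
proof
  show "sat (M\<^sub>1 \<oplus> M\<^sub>2) s e p \<Longrightarrow> sat (M\<^sub>1 \<oplus> M\<^sub>2) s' e' p"
    using assms(1)[unfolded determines_def, rule_format, OF assms(2-4)] assms(5-8) by simp
  have "length e' = d" using assms(4,6) list_all2_lengthD by metis
  moreover have "list_all2 (\<lambda>x y. x \<in> univ M\<^sub>1 \<longleftrightarrow> y \<in> univ M\<^sub>1) e' e"
    using assms(6) by (simp add: list_all2_conv_all_nth)
  ultimately show "sat (M\<^sub>1 \<oplus> M\<^sub>2) s' e' p \<Longrightarrow> sat (M\<^sub>1 \<oplus> M\<^sub>2) s e p"
    using assms(1)[unfolded determines_def, rule_format, OF assms(3,2)] assms(5,7,8) by simp
qed

lemma determines_mono: "determines M\<^sub>1 M\<^sub>2 d \<Psi> p \<Longrightarrow> \<Psi> \<subseteq> \<Psi>' \<Longrightarrow> determines M\<^sub>1 M\<^sub>2 d \<Psi>' p"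
  unfolding determines_def
  apply (intro allI impI)
  subgoal premises prems for s e s\<^sub>1 e\<^sub>1 s\<^sub>2 e\<^sub>2 s' e' s\<^sub>1' e\<^sub>1' s\<^sub>2' e\<^sub>2'
    by (rule prems(1)[rule_format, OF prems(3-5)]) (use prems in auto)
  done

lemma determinesI:
  assumes "\<And>s e s\<^sub>1 e\<^sub>1 s\<^sub>2 e\<^sub>2 s' e' s\<^sub>1' e\<^sub>1' s\<^sub>2' e\<^sub>2'.
     projections (univ M\<^sub>1) (univ M\<^sub>2) s e s\<^sub>1 e\<^sub>1 s\<^sub>2 e\<^sub>2 \<Longrightarrow>
     projections (univ M\<^sub>1) (univ M\<^sub>2) s' e' s\<^sub>1' e\<^sub>1' s\<^sub>2' e\<^sub>2' \<Longrightarrow>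
     length e = d \<Longrightarrow> length e' = d \<Longrightarrow>
     \<forall>v\<in>fm_frees p. s v \<in> univ M\<^sub>1 \<longleftrightarrow> s' v \<in> univ M\<^sub>1 \<Longrightarrow>
     list_all2 (\<lambda>x y. x \<in> univ M\<^sub>1 \<longleftrightarrow> y \<in> univ M\<^sub>1) e e' \<Longrightarrow>
     \<forall>\<psi>\<in>\<Psi>. sat M\<^sub>1 s\<^sub>1 e\<^sub>1 \<psi> \<longleftrightarrow> sat M\<^sub>1 s\<^sub>1' e\<^sub>1' \<psi> \<Longrightarrow>
     \<forall>\<psi>\<in>\<Psi>. sat M\<^sub>2 s\<^sub>2 e\<^sub>2 \<psi> \<longleftrightarrow> sat M\<^sub>2 s\<^sub>2' e\<^sub>2' \<psi> \<Longrightarrow>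
     sat (M\<^sub>1 \<oplus> M\<^sub>2) s e p \<Longrightarrow> sat (M\<^sub>1 \<oplus> M\<^sub>2) s' e' p"
  shows "determines M\<^sub>1 M\<^sub>2 d \<Psi> p"
  unfolding determines_def
proof (intro allI impI)
  fix s e s\<^sub>1 e\<^sub>1 s\<^sub>2 e\<^sub>2 s' e' s\<^sub>1' e\<^sub>1' s\<^sub>2' e\<^sub>2'
  assume *: "projections (univ M\<^sub>1) (univ M\<^sub>2) s e s\<^sub>1 e\<^sub>1 s\<^sub>2 e\<^sub>2"
     "projections (univ M\<^sub>1) (univ M\<^sub>2) s' e' s\<^sub>1' e\<^sub>1' s\<^sub>2' e\<^sub>2'" "length e = d"
     and **: "\<forall>v\<in>fm_frees p. s v \<in> univ M\<^sub>1 \<longleftrightarrow> s' v \<in> univ M\<^sub>1"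
     "list_all2 (\<lambda>x y. x \<in> univ M\<^sub>1 \<longleftrightarrow> y \<in> univ M\<^sub>1) e e'"
     "\<forall>\<psi>\<in>\<Psi>. sat M\<^sub>1 s\<^sub>1 e\<^sub>1 \<psi> \<longleftrightarrow> sat M\<^sub>1 s\<^sub>1' e\<^sub>1' \<psi>"
     "\<forall>\<psi>\<in>\<Psi>. sat M\<^sub>2 s\<^sub>2 e\<^sub>2 \<psi> \<longleftrightarrow> sat M\<^sub>2 s\<^sub>2' e\<^sub>2' \<psi>"
     "sat (M\<^sub>1 \<oplus> M\<^sub>2) s e p"
  have "length e' = d" using *(3) **(2) list_all2_lengthD by metis
  then show "sat (M\<^sub>1 \<oplus> M\<^sub>2) s' e' p" by (rule assms[OF * _ **])
qed

lemma tm_val_side: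
  assumes "tm_ok (length e) t" and "\<forall>v\<in>set_tm t. s v \<in> U \<longleftrightarrow> s' v \<in> U"
    and "list_all2 (\<lambda>x y. x \<in> U \<longleftrightarrow> y \<in> U) e e'"
  shows "tm_val s e t \<in> U \<longleftrightarrow> tm_val s' e' t \<in> U"
  using assms by (cases t) (auto simp: list_all2_conv_all_nth)

lemma univ_struct_sum [simp]: "univ (M\<^sub>1 \<oplus> M\<^sub>2) = univ M\<^sub>1 \<union> univ M\<^sub>2"
  by (simp add: struct_sum_def)

lemma rel_struct_sum [simp]:
  "rel (M\<^sub>1 \<oplus> M\<^sub>2) (Sym S) = rel M\<^sub>1 S \<union> rel M\<^sub>2 S"
  "rel (M\<^sub>1 \<oplus> M\<^sub>2) LPred = {[a] |a. a \<in> univ M\<^sub>1}"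
  "rel (M\<^sub>1 \<oplus> M\<^sub>2) RPred = {[a] |a. a \<in> univ M\<^sub>2}"
  by (simp_all add: struct_sum_def)

lemma projections_Cons:
  assumes "projections U\<^sub>1 U\<^sub>2 s e s\<^sub>1 e\<^sub>1 s\<^sub>2 e\<^sub>2" and "x \<in> U\<^sub>1 \<union> U\<^sub>2"
    and "proj_to U\<^sub>1 x x\<^sub>1" and "proj_to U\<^sub>2 x x\<^sub>2"
  shows "projections U\<^sub>1 U\<^sub>2 s (x # e) s\<^sub>1 (x\<^sub>1 # e\<^sub>1) s\<^sub>2 (x\<^sub>2 # e\<^sub>2)"
  using assms by (auto simp: projections_def)

text \<open>In the quantifier step the witness is matched by type on its own side and its dummy value by
  type on the other side, so that no independence from the dummy values has to be tracked.\<close>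

lemma feferman_vaught:
  fixes M\<^sub>1 M\<^sub>2 :: "('r, 'a) fo_struct" and p :: "('r lr_sym, 'v) fm"
  assumes str: "is_structure \<tau> M\<^sub>1" "is_structure \<tau> M\<^sub>2" and disj: "univ M\<^sub>1 \<inter> univ M\<^sub>2 = {}"
    and "wff (sum_vocab \<tau>) d p"
  shows "\<exists>\<Psi>. finite \<Psi> \<and> (\<forall>\<psi>\<in>\<Psi>. wff \<tau> d \<psi> \<and> fm_frees \<psi> \<subseteq> fm_frees p) \<and>
    determines M\<^sub>1 M\<^sub>2 d \<Psi> p"
  using assms(4)
proof (induction p arbitrary: d)
  case Bot
  show ?case by (rule exI[of _ "{}"]) (simp add: determines_def)
next
  case (Eql t u)
  then have ok: "tm_ok d t" "tm_ok d u" by auto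
  have "determines M\<^sub>1 M\<^sub>2 d {Eql t u} (Eql t u :: ('r lr_sym, 'v) fm)"
  proof (rule determinesI)
    fix s e s\<^sub>1 e\<^sub>1 s\<^sub>2 e\<^sub>2 s' e' s\<^sub>1' e\<^sub>1' s\<^sub>2' e\<^sub>2'
    assume P: "projections (univ M\<^sub>1) (univ M\<^sub>2) s e s\<^sub>1 e\<^sub>1 s\<^sub>2 e\<^sub>2"
      and P': "projections (univ M\<^sub>1) (univ M\<^sub>2) s' e' s\<^sub>1' e\<^sub>1' s\<^sub>2' e\<^sub>2'"
      and len: "length e = d" "length e' = d"
      and sides: "\<forall>v\<in>fm_frees (Eql t u :: ('r lr_sym, 'v) fm). s v \<in> univ M\<^sub>1 \<longleftrightarrow> s' v \<in> univ M\<^sub>1"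
        "list_all2 (\<lambda>x y. x \<in> univ M\<^sub>1 \<longleftrightarrow> y \<in> univ M\<^sub>1) e e'"
      and agree: "\<forall>\<psi>\<in>{Eql t u}. sat M\<^sub>1 s\<^sub>1 e\<^sub>1 \<psi> \<longleftrightarrow> sat M\<^sub>1 s\<^sub>1' e\<^sub>1' \<psi>"
        "\<forall>\<psi>\<in>{Eql t u}. sat M\<^sub>2 s\<^sub>2 e\<^sub>2 \<psi> \<longleftrightarrow> sat M\<^sub>2 s\<^sub>2' e\<^sub>2' \<psi>"
      and sat: "sat (M\<^sub>1 \<oplus> M\<^sub>2) s e (Eql t u)"
    note v = tm_val_projections[OF P, unfolded len, OF ok(1)]
      tm_val_projections[OF P, unfolded len, OF ok(2)]
    note v' = tm_val_projections[OF P', unfolded len, OF ok(1)]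
      tm_val_projections[OF P', unfolded len, OF ok(2)]
    have eq: "tm_val s e t = tm_val s e u" using sat by simp
    have t: "tm_val s e t \<in> univ M\<^sub>1 \<longleftrightarrow> tm_val s' e' t \<in> univ M\<^sub>1"
      and u: "tm_val s e u \<in> univ M\<^sub>1 \<longleftrightarrow> tm_val s' e' u \<in> univ M\<^sub>1"
      using tm_val_side[of e t s "univ M\<^sub>1" s' e'] tm_val_side[of e u s "univ M\<^sub>1" s' e'] sides ok len
      by auto
    show "sat (M\<^sub>1 \<oplus> M\<^sub>2) s' e' (Eql t u)"
    \<comment> \<open>Equal values lie on the same side, where the projection is the identity, so
      the equation is decided in that summand.\<close>
    proof (cases "tm_val s e t \<in> univ M\<^sub>1")
      case True
      then show ?thesis using v v' eq t u agree(1) by (simp add: proj_to_def)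
    next
      case False
      then have "tm_val s e t \<in> univ M\<^sub>2" "tm_val s' e' t \<in> univ M\<^sub>2" "tm_val s' e' u \<in> univ M\<^sub>2"
        using v v' eq t u by auto
      then show ?thesis using v v' eq agree(2) by (simp add: proj_to_def)
    qed
  qed
  then show ?case using ok by (intro exI[of _ "{Eql t u}"]) auto
next
  case (Rel R ts)
  have ok: "\<And>t. t \<in> set ts \<Longrightarrow> tm_ok d t" and arity: "sum_vocab \<tau> R = Some (length ts)"
    using Rel by auto
  have side: "tm_val s e t \<in> univ M\<^sub>1 \<longleftrightarrow> tm_val s' e' t \<in> univ M\<^sub>1"
    if "t \<in> set ts" "\<forall>v\<in>fm_frees (Rel R ts :: ('r lr_sym, 'v) fm). s v \<in> univ M\<^sub>1 \<longleftrightarrow> s' v \<in> univ M\<^sub>1"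
      "list_all2 (\<lambda>x y. x \<in> univ M\<^sub>1 \<longleftrightarrow> y \<in> univ M\<^sub>1) e e'" "length e = d"
    for s s' e e' t
    using tm_val_side[of e t s "univ M\<^sub>1" s' e'] that ok by auto
  \<comment> \<open>By disjointness, the two sides are complementary, so agreement about membership
    in \<open>M\<^sub>1\<close> gives agreement about \<open>M\<^sub>2\<close>.\<close>
  have side2: "tm_val s e t \<in> univ M\<^sub>2 \<longleftrightarrow> tm_val s e t \<notin> univ M\<^sub>1"
    if "t \<in> set ts" "projections (univ M\<^sub>1) (univ M\<^sub>2) s e s\<^sub>1 e\<^sub>1 s\<^sub>2 e\<^sub>2" "length e = d"
    for s e t s\<^sub>1 e\<^sub>1 s\<^sub>2 e\<^sub>2
    using tm_val_projections(1)[OF that(2), of t] ok[OF that(1)] that(3) disj by auto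
  show ?case
  proof (cases R)
    case (Sym S)
    have ar: "\<tau> S = Some (length ts)" using arity Sym by (simp add: sum_vocab_def)
    have "determines M\<^sub>1 M\<^sub>2 d {Rel S ts} (Rel R ts)"
    proof (rule determinesI)
      fix s e s\<^sub>1 e\<^sub>1 s\<^sub>2 e\<^sub>2 s' e' s\<^sub>1' e\<^sub>1' s\<^sub>2' e\<^sub>2'
      assume P: "projections (univ M\<^sub>1) (univ M\<^sub>2) s e s\<^sub>1 e\<^sub>1 s\<^sub>2 e\<^sub>2"
        and P': "projections (univ M\<^sub>1) (univ M\<^sub>2) s' e' s\<^sub>1' e\<^sub>1' s\<^sub>2' e\<^sub>2'"
        and len: "length e = d" "length e' = d"
        and sides: "\<forall>v\<in>fm_frees (Rel R ts). s v \<in> univ M\<^sub>1 \<longleftrightarrow> s' v \<in> univ M\<^sub>1"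
          "list_all2 (\<lambda>x y. x \<in> univ M\<^sub>1 \<longleftrightarrow> y \<in> univ M\<^sub>1) e e'"
        and agree: "\<forall>\<psi>\<in>{Rel S ts}. sat M\<^sub>1 s\<^sub>1 e\<^sub>1 \<psi> \<longleftrightarrow> sat M\<^sub>1 s\<^sub>1' e\<^sub>1' \<psi>"
          "\<forall>\<psi>\<in>{Rel S ts}. sat M\<^sub>2 s\<^sub>2 e\<^sub>2 \<psi> \<longleftrightarrow> sat M\<^sub>2 s\<^sub>2' e\<^sub>2' \<psi>"
        and sat: "sat (M\<^sub>1 \<oplus> M\<^sub>2) s e (Rel R ts)"
      \<comment> \<open>A relation of the sum holds of a tuple only if all entries lie on one side,
        and then it is decided by the projection to that side.\<close>
      have split: "map (tm_val s e) ts \<in> rel M\<^sub>1 S \<longleftrightarrow>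
          (\<forall>t\<in>set ts. tm_val s e t \<in> univ M\<^sub>1) \<and> map (tm_val s\<^sub>1 e\<^sub>1) ts \<in> rel M\<^sub>1 S"
        "map (tm_val s e) ts \<in> rel M\<^sub>2 S \<longleftrightarrow>
          (\<forall>t\<in>set ts. tm_val s e t \<in> univ M\<^sub>2) \<and> map (tm_val s\<^sub>2 e\<^sub>2) ts \<in> rel M\<^sub>2 S"
        if "projections (univ M\<^sub>1) (univ M\<^sub>2) s e s\<^sub>1 e\<^sub>1 s\<^sub>2 e\<^sub>2" "length e = d" for s e s\<^sub>1 e\<^sub>1 s\<^sub>2 e\<^sub>2
        using map_tm_val_projection_in_rel[OF str(1) ar, of ts "tm_val s e" "tm_val s\<^sub>1 e\<^sub>1"]
          map_tm_val_projection_in_rel[OF str(2) ar, of ts "tm_val s e" "tm_val s\<^sub>2 e\<^sub>2"]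
          tm_val_projections[OF that(1)] ok that(2) by simp_all
      have "(\<forall>t\<in>set ts. tm_val s e t \<in> univ M\<^sub>1) \<longleftrightarrow> (\<forall>t\<in>set ts. tm_val s' e' t \<in> univ M\<^sub>1)"
        "(\<forall>t\<in>set ts. tm_val s e t \<in> univ M\<^sub>2) \<longleftrightarrow> (\<forall>t\<in>set ts. tm_val s' e' t \<in> univ M\<^sub>2)"
        using side[OF _ sides len(1)] side2[OF _ P len(1)] side2[OF _ P' len(2)] by simp_all
      then show "sat (M\<^sub>1 \<oplus> M\<^sub>2) s' e' (Rel R ts)"
        using sat agree split[OF P len(1)] split[OF P' len(2)] by (simp add: Sym)
    qed
    moreover have "fm_frees (Rel S ts) \<subseteq> fm_frees (Rel R ts)" by simp
    ultimately show ?thesis using ok ar by (intro exI[of _ "{Rel S ts}"]) auto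
  next
    case LPred
    then obtain t where t: "ts = [t]" using arity
      by (cases ts) (auto simp: sum_vocab_def)
    have "determines M\<^sub>1 M\<^sub>2 d {} (Rel R ts)"
    proof (rule determinesI)
      fix s e s' e'
      assume len: "length e = d"
        and sides: "\<forall>v\<in>fm_frees (Rel R ts). s v \<in> univ M\<^sub>1 \<longleftrightarrow> s' v \<in> univ M\<^sub>1"
          "list_all2 (\<lambda>x y. x \<in> univ M\<^sub>1 \<longleftrightarrow> y \<in> univ M\<^sub>1) e e'"
        and sat: "sat (M\<^sub>1 \<oplus> M\<^sub>2) s e (Rel R ts)"
      have "t \<in> set ts" by (simp add: t)
      then show "sat (M\<^sub>1 \<oplus> M\<^sub>2) s' e' (Rel R ts)"
        using sat side[OF _ sides len, of t] by (simp add: t LPred)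
    qed
    then show ?thesis by (intro exI[of _ "{}"]) auto
  next
    case RPred
    then obtain t where t: "ts = [t]" using arity
      by (cases ts) (auto simp: sum_vocab_def)
    have "determines M\<^sub>1 M\<^sub>2 d {} (Rel R ts)"
    proof (rule determinesI)
      fix s e s\<^sub>1 e\<^sub>1 s\<^sub>2 e\<^sub>2 s' e' s\<^sub>1' e\<^sub>1' s\<^sub>2' e\<^sub>2'
      assume P: "projections (univ M\<^sub>1) (univ M\<^sub>2) s e s\<^sub>1 e\<^sub>1 s\<^sub>2 e\<^sub>2"
        and P': "projections (univ M\<^sub>1) (univ M\<^sub>2) s' e' s\<^sub>1' e\<^sub>1' s\<^sub>2' e\<^sub>2'"
        and len: "length e = d" "length e' = d"
        and sides: "\<forall>v\<in>fm_frees (Rel R ts). s v \<in> univ M\<^sub>1 \<longleftrightarrow> s' v \<in> univ M\<^sub>1"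
          "list_all2 (\<lambda>x y. x \<in> univ M\<^sub>1 \<longleftrightarrow> y \<in> univ M\<^sub>1) e e'"
        and sat: "sat (M\<^sub>1 \<oplus> M\<^sub>2) s e (Rel R ts)"
      have "t \<in> set ts" by (simp add: t)
      then show "sat (M\<^sub>1 \<oplus> M\<^sub>2) s' e' (Rel R ts)"
        using sat side[OF _ sides len(1), of t] side2[OF _ P len(1), of t] side2[OF _ P' len(2), of t]
        by (simp add: t RPred)
    qed
    then show ?thesis by (intro exI[of _ "{}"]) auto
  qed
next
  case (Imp p q)
  then have w: "wff (sum_vocab \<tau>) d p" "wff (sum_vocab \<tau>) d q" by auto
  obtain \<Psi>p where p: "finite \<Psi>p" "\<forall>\<psi>\<in>\<Psi>p. wff \<tau> d \<psi> \<and> fm_frees \<psi> \<subseteq> fm_frees p"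
    "determines M\<^sub>1 M\<^sub>2 d \<Psi>p p"
    using Imp.IH(1)[OF w(1)] by (elim exE conjE)
  obtain \<Psi>q where q: "finite \<Psi>q" "\<forall>\<psi>\<in>\<Psi>q. wff \<tau> d \<psi> \<and> fm_frees \<psi> \<subseteq> fm_frees q"
    "determines M\<^sub>1 M\<^sub>2 d \<Psi>q q"
    using Imp.IH(2)[OF w(2)] by (elim exE conjE)
  have det: "determines M\<^sub>1 M\<^sub>2 d (\<Psi>p \<union> \<Psi>q) p" "determines M\<^sub>1 M\<^sub>2 d (\<Psi>p \<union> \<Psi>q) q"
    using determines_mono p(3) q(3) by blast+
  have "determines M\<^sub>1 M\<^sub>2 d (\<Psi>p \<union> \<Psi>q) (Imp p q)"
  proof (rule determinesI)
    fix s e s\<^sub>1 e\<^sub>1 s\<^sub>2 e\<^sub>2 s' e' s\<^sub>1' e\<^sub>1' s\<^sub>2' e\<^sub>2'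
    assume P: "projections (univ M\<^sub>1) (univ M\<^sub>2) s e s\<^sub>1 e\<^sub>1 s\<^sub>2 e\<^sub>2"
      "projections (univ M\<^sub>1) (univ M\<^sub>2) s' e' s\<^sub>1' e\<^sub>1' s\<^sub>2' e\<^sub>2'" "length e = d"
      and sides: "\<forall>v\<in>fm_frees (Imp p q). s v \<in> univ M\<^sub>1 \<longleftrightarrow> s' v \<in> univ M\<^sub>1"
      and agree: "list_all2 (\<lambda>x y. x \<in> univ M\<^sub>1 \<longleftrightarrow> y \<in> univ M\<^sub>1) e e'"
        "\<forall>\<psi>\<in>\<Psi>p \<union> \<Psi>q. sat M\<^sub>1 s\<^sub>1 e\<^sub>1 \<psi> \<longleftrightarrow> sat M\<^sub>1 s\<^sub>1' e\<^sub>1' \<psi>"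
        "\<forall>\<psi>\<in>\<Psi>p \<union> \<Psi>q. sat M\<^sub>2 s\<^sub>2 e\<^sub>2 \<psi> \<longleftrightarrow> sat M\<^sub>2 s\<^sub>2' e\<^sub>2' \<psi>"
      and sat: "sat (M\<^sub>1 \<oplus> M\<^sub>2) s e (Imp p q)"
    have "sat (M\<^sub>1 \<oplus> M\<^sub>2) s e p \<longleftrightarrow> sat (M\<^sub>1 \<oplus> M\<^sub>2) s' e' p"
      using sides by (intro determinesD[OF det(1) P _ agree]) simp
    moreover have "sat (M\<^sub>1 \<oplus> M\<^sub>2) s e q \<longleftrightarrow> sat (M\<^sub>1 \<oplus> M\<^sub>2) s' e' q"
      using sides by (intro determinesD[OF det(2) P _ agree]) simp
    ultimately show "sat (M\<^sub>1 \<oplus> M\<^sub>2) s' e' (Imp p q)" using sat by simp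
  qed
  then show ?case using p(1,2) q(1,2) by (intro exI[of _ "\<Psi>p \<union> \<Psi>q"]) auto
next
  case (All p)
  then have w: "wff (sum_vocab \<tau>) (Suc d) p" by simp
  obtain \<Psi> where \<Psi>: "finite \<Psi>" "\<forall>\<psi>\<in>\<Psi>. wff \<tau> (Suc d) \<psi> \<and> fm_frees \<psi> \<subseteq> fm_frees p"
    "determines M\<^sub>1 M\<^sub>2 (Suc d) \<Psi> p"
    using All.IH[OF w] by (elim exE conjE)
  obtain \<Phi> where \<Phi>: "finite \<Phi>" "\<forall>\<phi>\<in>\<Phi>. wff \<tau> d \<phi> \<and> fm_frees \<phi> \<subseteq> fm_frees p"
    "\<forall>(M :: ('r, 'a) fo_struct) s e s' e'. (\<forall>\<phi>\<in>\<Phi>. sat M s e \<phi> \<longleftrightarrow> sat M s' e' \<phi>) \<longrightarrow>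
      (\<forall>x\<in>univ M. \<exists>y\<in>univ M. \<forall>\<psi>\<in>\<Psi>. sat M s (x # e) \<psi> \<longleftrightarrow> sat M s' (y # e') \<psi>)"
    using type_realization_formulas_exist[OF \<Psi>(1,2), where ?'a = 'a]
    by (elim exE conjE)
  have "determines M\<^sub>1 M\<^sub>2 d \<Phi> (All p)"
  proof (rule determinesI)
    fix s e s\<^sub>1 e\<^sub>1 s\<^sub>2 e\<^sub>2 s' e' s\<^sub>1' e\<^sub>1' s\<^sub>2' e\<^sub>2'
    assume P: "projections (univ M\<^sub>1) (univ M\<^sub>2) s e s\<^sub>1 e\<^sub>1 s\<^sub>2 e\<^sub>2"
      and P': "projections (univ M\<^sub>1) (univ M\<^sub>2) s' e' s\<^sub>1' e\<^sub>1' s\<^sub>2' e\<^sub>2'"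
      and len: "length e = d" "length e' = d"
      and sides: "\<forall>v\<in>fm_frees (All p). s v \<in> univ M\<^sub>1 \<longleftrightarrow> s' v \<in> univ M\<^sub>1"
        "list_all2 (\<lambda>x y. x \<in> univ M\<^sub>1 \<longleftrightarrow> y \<in> univ M\<^sub>1) e e'"
      and agree: "\<forall>\<psi>\<in>\<Phi>. sat M\<^sub>1 s\<^sub>1 e\<^sub>1 \<psi> \<longleftrightarrow> sat M\<^sub>1 s\<^sub>1' e\<^sub>1' \<psi>"
        "\<forall>\<psi>\<in>\<Phi>. sat M\<^sub>2 s\<^sub>2 e\<^sub>2 \<psi> \<longleftrightarrow> sat M\<^sub>2 s\<^sub>2' e\<^sub>2' \<psi>"
      and sat: "sat (M\<^sub>1 \<oplus> M\<^sub>2) s e (All p)"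
    have "sat (M\<^sub>1 \<oplus> M\<^sub>2) s' (x' # e') p" if x': "x' \<in> univ M\<^sub>1 \<union> univ M\<^sub>2" for x'
    proof -
      obtain c\<^sub>1 c\<^sub>2 where c: "c\<^sub>1 \<in> univ M\<^sub>1" "c\<^sub>2 \<in> univ M\<^sub>2"
        using str by (auto simp: is_structure_def)
      define x\<^sub>1' where "x\<^sub>1' = (if x' \<in> univ M\<^sub>1 then x' else c\<^sub>1)"
      define x\<^sub>2' where "x\<^sub>2' = (if x' \<in> univ M\<^sub>2 then x' else c\<^sub>2)"
      have proj': "proj_to (univ M\<^sub>1) x' x\<^sub>1'" "proj_to (univ M\<^sub>2) x' x\<^sub>2'"
        using c by (auto simp: proj_to_def x\<^sub>1'_def x\<^sub>2'_def)
      then have mem: "x\<^sub>1' \<in> univ M\<^sub>1" "x\<^sub>2' \<in> univ M\<^sub>2" by (auto simp: proj_to_def)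
      \<comment> \<open>The element to be tested lives under the primed assignment and must be
        pulled back to the unprimed one, where \<open>All p\<close> is known. Hence the agreement is
        used in reverse.\<close>
      have agree': "\<forall>\<phi>\<in>\<Phi>. sat M\<^sub>1 s\<^sub>1' e\<^sub>1' \<phi> \<longleftrightarrow> sat M\<^sub>1 s\<^sub>1 e\<^sub>1 \<phi>"
        "\<forall>\<phi>\<in>\<Phi>. sat M\<^sub>2 s\<^sub>2' e\<^sub>2' \<phi> \<longleftrightarrow> sat M\<^sub>2 s\<^sub>2 e\<^sub>2 \<phi>"
        using agree by auto
      obtain x\<^sub>1 where x\<^sub>1: "x\<^sub>1 \<in> univ M\<^sub>1"
        "\<forall>\<psi>\<in>\<Psi>. sat M\<^sub>1 s\<^sub>1' (x\<^sub>1' # e\<^sub>1') \<psi> \<longleftrightarrow> sat M\<^sub>1 s\<^sub>1 (x\<^sub>1 # e\<^sub>1) \<psi>"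
        using \<Phi>(3)[THEN spec, THEN spec, THEN spec, THEN spec, THEN spec, THEN HOL.mp,
          OF agree'(1), THEN bspec, OF mem(1)] by (elim bexE)
      obtain x\<^sub>2 where x\<^sub>2: "x\<^sub>2 \<in> univ M\<^sub>2"
        "\<forall>\<psi>\<in>\<Psi>. sat M\<^sub>2 s\<^sub>2' (x\<^sub>2' # e\<^sub>2') \<psi> \<longleftrightarrow> sat M\<^sub>2 s\<^sub>2 (x\<^sub>2 # e\<^sub>2) \<psi>"
        using \<Phi>(3)[THEN spec, THEN spec, THEN spec, THEN spec, THEN spec, THEN HOL.mp,
          OF agree'(2), THEN bspec, OF mem(2)] by (elim bexE)
      define x where "x = (if x' \<in> univ M\<^sub>1 then x\<^sub>1 else x\<^sub>2)"
      have x: "x \<in> univ M\<^sub>1 \<union> univ M\<^sub>2" "x \<in> univ M\<^sub>1 \<longleftrightarrow> x' \<in> univ M\<^sub>1"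
        "proj_to (univ M\<^sub>1) x x\<^sub>1" "proj_to (univ M\<^sub>2) x x\<^sub>2"
        using x\<^sub>1(1) x\<^sub>2(1) disj by (auto simp: x_def proj_to_def)
      have "sat (M\<^sub>1 \<oplus> M\<^sub>2) s (x # e) p \<longleftrightarrow> sat (M\<^sub>1 \<oplus> M\<^sub>2) s' (x' # e') p"
        using sides x(2) len x\<^sub>1(2) x\<^sub>2(2)
        by (intro determinesD[OF \<Psi>(3) projections_Cons[OF P x(1,3,4)]
              projections_Cons[OF P' x' proj']]) auto
      then show ?thesis using sat x(1) by simp
    qed
    then show "sat (M\<^sub>1 \<oplus> M\<^sub>2) s' e' (All p)" by simp
  qed
  then show ?case using \<Phi>(1,2) by (intro exI[of _ \<Phi>]) auto
qed

section \<open>Patterns in a sum of structures\<close>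

definition join_asg :: "nat \<Rightarrow> (nat \<Rightarrow> 'a) \<Rightarrow> (nat \<Rightarrow> 'a) \<Rightarrow> nat \<Rightarrow> 'a" where
  "join_asg k b b' v = (if v < k then b v else b' (v - k))"

text \<open>The formula is the disjunction over \<Psi> of the failures of equivalence between a
  formula at the first and at the second parameter tuple. It is chosen before the structure, so one
  formula serves both summands.\<close>

lemma difference_formula_exists:
  fixes \<Psi> :: "('r, nat) fm set"
  assumes "finite \<Psi>" and "\<forall>\<psi>\<in>\<Psi>. wff \<tau> 0 \<psi> \<and> fm_frees \<psi> \<subseteq> {..<n + k}"
  shows "\<exists>\<chi>. wff \<tau> 0 \<chi> \<and> fm_frees \<chi> \<subseteq> {..<n + 2 * k} \<and>
    (\<forall>(M :: ('r, 'a) fo_struct) a b b'. sat M (split_asg n a (join_asg k b b')) [] \<chi> \<longleftrightarrow>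
      {\<psi>\<in>\<Psi>. sat M (split_asg n a b) [] \<psi>} \<noteq> {\<psi>\<in>\<Psi>. sat M (split_asg n a b') [] \<psi>})"
  using assms
proof (induction \<Psi> rule: finite_induct)
  case empty
  show ?case by (rule exI[of _ Bot]) simp
next
  case (insert \<psi> \<Psi>)
  have "\<forall>\<psi>\<in>\<Psi>. wff \<tau> 0 \<psi> \<and> fm_frees \<psi> \<subseteq> {..<n + k}" using insert.prems by simp
  from insert.IH[OF this] obtain \<chi> where \<chi>: "wff \<tau> 0 \<chi>" "fm_frees \<chi> \<subseteq> {..<n + 2 * k}"
    "\<forall>(M :: ('r, 'a) fo_struct) a b b'. sat M (split_asg n a (join_asg k b b')) [] \<chi> \<longleftrightarrow>
      {\<psi>\<in>\<Psi>. sat M (split_asg n a b) [] \<psi>} \<noteq> {\<psi>\<in>\<Psi>. sat M (split_asg n a b') [] \<psi>}"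
    by (elim exE conjE)
  \<comment> \<open>Keeps the first \<open>n\<close> variables and moves the parameters to the
    second block of the joined tuple.\<close>
  define g where "g v = (if v < n then v else v + k)" for v
  define \<psi>' where "\<psi>' = map_fm id g \<psi>"
  \<comment> \<open>This reads: \<chi> holds or \<psi> and \<open>\<psi>'\<close> are not
    equivalent.\<close>
  define \<chi>' where "\<chi>' = Imp (Neg \<chi>) (Imp (Imp \<psi> \<psi>') (Neg (Imp \<psi>' \<psi>)))"
  have wff: "wff \<tau> 0 \<psi>" and frees: "fm_frees \<psi> \<subseteq> {..<n + k}" using insert.prems by auto
  have "fm_frees \<psi>' \<subseteq> {..<n + 2 * k}" using frees by (auto simp: \<psi>'_def fm.set_map g_def)
  then have "wff \<tau> 0 \<chi>'" "fm_frees \<chi>' \<subseteq> {..<n + 2 * k}"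
    using wff frees \<chi>(1,2) by (auto simp: \<chi>'_def \<psi>'_def)
  moreover have "sat M (split_asg n a (join_asg k b b')) [] \<chi>' \<longleftrightarrow>
      {\<psi>'\<in>insert \<psi> \<Psi>. sat M (split_asg n a b) [] \<psi>'} \<noteq> {\<psi>'\<in>insert \<psi> \<Psi>. sat M (split_asg n a b') [] \<psi>'}"
    for M :: "('r, 'a) fo_struct" and a b b'
  proof -
    have "sat M (split_asg n a (join_asg k b b')) [] \<psi> \<longleftrightarrow> sat M (split_asg n a b) [] \<psi>"
      using frees by (intro sat_cong) (auto simp: split_asg_def join_asg_def)
    moreover have "split_asg n a (join_asg k b b') \<circ> g = split_asg n a b'"
      by (rule ext) (auto simp: split_asg_def join_asg_def g_def)
    then have "sat M (split_asg n a (join_asg k b b')) [] \<psi>' \<longleftrightarrow> sat M (split_asg n a b') [] \<psi>"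
      unfolding \<psi>'_def sat_map_fm by simp
    ultimately show ?thesis using \<chi>(3) insert.hyps(2) unfolding \<chi>'_def by (auto simp: set_eq_iff)
  qed
  ultimately show ?case by blast
qed

section \<open>Patterns constrained only on a given set of rows\<close>

definition partial_pattern ::
    "('r, 'a) fo_struct \<Rightarrow> nat \<Rightarrow> (nat \<Rightarrow> ('r, nat) fm) \<Rightarrow> nat set \<Rightarrow> nat \<Rightarrow> bool" where
  "partial_pattern M n \<chi> I N \<longleftrightarrow> (\<exists>(a :: (nat \<Rightarrow> nat) \<Rightarrow> nat \<Rightarrow> 'a) b.
     (\<forall>\<eta>. range (a \<eta>) \<subseteq> univ M) \<and> (\<forall>i j. range (b i j) \<subseteq> univ M) \<and>
     (\<forall>\<eta> i j. (\<forall>l. \<eta> l < N) \<longrightarrow> i < N \<longrightarrow> i \<in> I \<longrightarrow> j < N \<longrightarrow>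
        (sat M (split_asg n (a \<eta>) (b i j)) [] (\<chi> i) \<longleftrightarrow> \<eta> i = j)))"

text \<open>The rows in \<open>I\<close> are renumbered by the enumeration of \<open>I\<close>. The
  remaining rows carry no condition, so an index function may take the value 0 there.\<close>

lemma partial_patterns_not_strongly_dependent1:
  assumes inf: "infinite I" and pat: "\<And>N. partial_pattern M n \<chi> I N"
    and wff: "\<And>i. wff \<tau> 0 (\<chi> i) \<and> fm_frees (\<chi> i) \<subseteq> {..<n + k i}"
  shows "\<not> strongly_dependent1 \<tau> (Th \<tau> M)"
proof -
  let ?en = "enumerate I"
  have mono: "strict_mono ?en" by (rule strict_mono_enumerate[OF inf])
  have "finite_pattern M n (\<lambda>t. \<chi> (?en t)) N" for N
  proof -
    \<comment> \<open>Large enough to contain the first \<open>N\<close> rows of \<open>I\<close> as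
      well as the first \<open>N\<close> columns.\<close>
    define N' where "N' = Suc (?en N)"
    have "N < N'" unfolding N'_def using le_enumerate[OF inf, of N] by simp
    obtain a b where ab: "\<forall>\<eta>. range (a \<eta>) \<subseteq> univ M" "\<forall>i j. range (b i j) \<subseteq> univ M"
      and sat: "\<forall>\<eta> i j. (\<forall>l. \<eta> l < N') \<longrightarrow> i < N' \<longrightarrow> i \<in> I \<longrightarrow> j < N' \<longrightarrow>
        (sat M (split_asg n (a \<eta>) (b i j)) [] (\<chi> i) \<longleftrightarrow> \<eta> i = j)"
      using pat[of N'] unfolding partial_pattern_def by (elim exE conjE)
    define push where "push \<eta> i = (if i \<in> range ?en then \<eta> (inv ?en i) else 0)" for \<eta> :: "nat \<Rightarrow> nat" and i
    have push: "push \<eta> (?en t) = \<eta> t" for \<eta> t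
      using strict_mono_imp_inj_on[OF mono] by (simp add: push_def)
    have "sat M (split_asg n (a (push \<eta>)) (b (?en t) j)) [] (\<chi> (?en t)) \<longleftrightarrow> \<eta> t = j"
      if "\<forall>l. \<eta> l < N" "t < N" "j < N" for \<eta> t j
    proof -
      have "\<forall>l. push \<eta> l < N'" using that \<open>N < N'\<close> by (auto simp: push_def intro: less_trans)
      moreover have "?en t < N'" using mono \<open>t < N\<close> by (simp add: N'_def strict_mono_less less_SucI)
      ultimately show ?thesis
        using sat enumerate_in_set[OF inf, of t] push[of \<eta> t] that(3) \<open>N < N'\<close> by simp
    qed
    then show ?thesis unfolding finite_pattern_def using ab
      by (intro exI[of _ "\<lambda>\<eta>. a (push \<eta>)"] exI[of _ "\<lambda>t. b (?en t)"]) simp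
  qed
  then show ?thesis unfolding strongly_dependent1_Th_iff not_not using wff
    by (intro exI[of _ n] exI[of _ "\<lambda>t. k (?en t)"] exI[of _ "\<lambda>t. \<chi> (?en t)"] conjI allI) simp_all
qed

section \<open>From patterns in the sum to patterns in the summands\<close>

lemma comp_split_asg: "f \<circ> split_asg n a b = split_asg n (f \<circ> a) (f \<circ> b)"
  by (rule ext) (auto simp: split_asg_def)

lemma range_split_asg: "range a \<subseteq> U \<Longrightarrow> range b \<subseteq> U \<Longrightarrow> range (split_asg n a b) \<subseteq> U"
  by (auto simp: split_asg_def)

lemma range_join_asg: "range b \<subseteq> U \<Longrightarrow> range b' \<subseteq> U \<Longrightarrow> range (join_asg k b b') \<subseteq> U"
  by (auto simp: join_asg_def)

text \<open>The code of an assignment (sides, left type, right type) decides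
  \<open>\<phi> i\<close>. In a homogeneous array the code is \<open>A i\<close>, \<open>B i\<close>
  or \<open>C i\<close> as the column lies before, at or after \<open>\<eta> i\<close>. The codes
  \<open>A i\<close> and \<open>B i\<close> differ in the left or the right type, and the rows are
  divided accordingly. A pair of consecutive columns then has different types exactly when it
  straddles the step from \<open>A i\<close> to \<open>B i\<close>.\<close>

lemma partial_patterns_in_summands:
  fixes M\<^sub>1 M\<^sub>2 :: "('r, 'a) fo_struct" and \<phi> :: "nat \<Rightarrow> ('r lr_sym, nat) fm"
    and \<Psi> :: "nat \<Rightarrow> ('r, nat) fm set"
  assumes ne: "univ M\<^sub>1 \<noteq> {}" "univ M\<^sub>2 \<noteq> {}" and disj: "univ M\<^sub>1 \<inter> univ M\<^sub>2 = {}"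
    and frees: "\<And>i. fm_frees (\<phi> i) \<subseteq> {..<n + k i}"
    and fin: "\<And>i. finite (\<Psi> i)" and det: "\<And>i. determines M\<^sub>1 M\<^sub>2 0 (\<Psi> i) (\<phi> i)"
    and diff: "\<And>i (M :: ('r, 'a) fo_struct) a b b'.
      sat M (split_asg n a (join_asg (k i) b b')) [] (\<chi> i) \<longleftrightarrow>
      {\<psi>\<in>\<Psi> i. sat M (split_asg n a b) [] \<psi>} \<noteq> {\<psi>\<in>\<Psi> i. sat M (split_asg n a b') [] \<psi>}"
    and pat: "\<And>N. finite_pattern (M\<^sub>1 \<oplus> M\<^sub>2) n \<phi> N"
  shows "\<exists>I. partial_pattern M\<^sub>1 n \<chi> I N \<and> partial_pattern M\<^sub>2 n \<chi> (- I) N"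
proof -
  obtain c\<^sub>1 c\<^sub>2 where c: "c\<^sub>1 \<in> univ M\<^sub>1" "c\<^sub>2 \<in> univ M\<^sub>2" using ne by blast
  define p\<^sub>1 where "p\<^sub>1 x = (if x \<in> univ M\<^sub>1 then x else c\<^sub>1)" for x
  define p\<^sub>2 where "p\<^sub>2 x = (if x \<in> univ M\<^sub>2 then x else c\<^sub>2)" for x
  have p: "proj_to (univ M\<^sub>1) x (p\<^sub>1 x)" "proj_to (univ M\<^sub>2) x (p\<^sub>2 x)" for x
    using c by (auto simp: proj_to_def p\<^sub>1_def p\<^sub>2_def)
  define side where "side i s = {v\<in>{..<n + k i}. s v \<in> univ M\<^sub>1}" for i s
  define left where "left i s = {\<psi>\<in>\<Psi> i. sat M\<^sub>1 (p\<^sub>1 \<circ> s) [] \<psi>}" for i s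
  define right where "right i s = {\<psi>\<in>\<Psi> i. sat M\<^sub>2 (p\<^sub>2 \<circ> s) [] \<psi>}" for i s
  define code where "code i s = (side i s, left i s, right i s)" for i s
  have left_code: "left i s = fst (snd (code i s))" and right_code: "right i s = snd (snd (code i s))"
    for i s by (simp_all add: code_def)
  have code_sat: "sat (M\<^sub>1 \<oplus> M\<^sub>2) s [] (\<phi> i) \<longleftrightarrow> sat (M\<^sub>1 \<oplus> M\<^sub>2) s' [] (\<phi> i)"
    if eq: "code i s = code i s'" and r: "range s \<subseteq> univ M\<^sub>1 \<union> univ M\<^sub>2" "range s' \<subseteq> univ M\<^sub>1 \<union> univ M\<^sub>2"
    for i s s'
  proof (rule determinesD[OF det])
    show "projections (univ M\<^sub>1) (univ M\<^sub>2) s [] (p\<^sub>1 \<circ> s) [] (p\<^sub>2 \<circ> s) []"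
      "projections (univ M\<^sub>1) (univ M\<^sub>2) s' [] (p\<^sub>1 \<circ> s') [] (p\<^sub>2 \<circ> s') []"
      using r p by (simp_all add: projections_def)
    show "\<forall>v\<in>fm_frees (\<phi> i). s v \<in> univ M\<^sub>1 \<longleftrightarrow> s' v \<in> univ M\<^sub>1"
      using eq frees[of i] unfolding code_def side_def by blast
    show "\<forall>\<psi>\<in>\<Psi> i. sat M\<^sub>1 (p\<^sub>1 \<circ> s) [] \<psi> \<longleftrightarrow> sat M\<^sub>1 (p\<^sub>1 \<circ> s') [] \<psi>"
      using eq unfolding code_def left_def by blast
    show "\<forall>\<psi>\<in>\<Psi> i. sat M\<^sub>2 (p\<^sub>2 \<circ> s) [] \<psi> \<longleftrightarrow> sat M\<^sub>2 (p\<^sub>2 \<circ> s') [] \<psi>"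
      using eq unfolding code_def right_def by blast
  qed simp_all
  define Codes where "Codes i = Pow {..<n + k i} \<times> Pow (\<Psi> i) \<times> Pow (\<Psi> i)" for i
  have "finite (Codes i)" for i using fin by (simp add: Codes_def)
  \<comment> \<open>Each of the \<open>N\<close> columns of the new pattern consumes two old ones.
    The two extra columns leave room below and above the positions used by \<eta>.\<close>
  from homogeneous_array[of Codes N "2 * N + 2", OF this] obtain R where
    R: "\<forall>F :: nat \<Rightarrow> (nat \<Rightarrow> nat) \<Rightarrow> nat \<Rightarrow> _. (\<forall>i \<eta> j. F i \<eta> j \<in> Codes i) \<longrightarrow>
    (\<exists>h A B C. (\<forall>i<N. \<forall>j<2 * N + 2. h i j < R) \<and>
      (\<forall>i<N. \<forall>j j'. j < j' \<longrightarrow> j' < 2 * N + 2 \<longrightarrow> h i j < h i j') \<and>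
      (\<forall>\<eta> i j. (\<forall>l<N. 0 < \<eta> l \<and> Suc (\<eta> l) < 2 * N + 2) \<longrightarrow> i < N \<longrightarrow> j < 2 * N + 2 \<longrightarrow>
         F i (\<lambda>l. if l < N then h l (\<eta> l) else 0) (h i j) =
           (if j < \<eta> i then A i else if j = \<eta> i then B i else C i)))"
    by (elim exE)
  \<comment> \<open>The size must exceed both the column indices, which are below \<open>R\<close>,
    and the row indices, which are below \<open>N\<close>.\<close>
  obtain a b where ab: "\<forall>\<eta>. range (a \<eta>) \<subseteq> univ (M\<^sub>1 \<oplus> M\<^sub>2)" "\<forall>i j. range (b i j) \<subseteq> univ (M\<^sub>1 \<oplus> M\<^sub>2)"
    and sat: "\<forall>\<eta> i j. (\<forall>l. \<eta> l < max R N) \<longrightarrow> i < max R N \<longrightarrow> j < max R N \<longrightarrow>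
      (sat (M\<^sub>1 \<oplus> M\<^sub>2) (split_asg n (a \<eta>) (b i j)) [] (\<phi> i) \<longleftrightarrow> \<eta> i = j)"
    using pat[of "max R N"] unfolding finite_pattern_def by (elim exE conjE)
  have "\<forall>i \<eta> j. code i (split_asg n (a \<eta>) (b i j)) \<in> Codes i"
    by (auto simp: code_def Codes_def side_def left_def right_def)
  from R[THEN spec, of "\<lambda>i \<eta> j. code i (split_asg n (a \<eta>) (b i j))", THEN HOL.mp, OF this]
  obtain h A B C where hR: "\<forall>i<N. \<forall>j<2 * N + 2. h i j < R"
    and hmono: "\<forall>i<N. \<forall>j j'. j < j' \<longrightarrow> j' < 2 * N + 2 \<longrightarrow> h i j < h i j'"
    and hom: "\<forall>\<eta> i j. (\<forall>l<N. 0 < \<eta> l \<and> Suc (\<eta> l) < 2 * N + 2) \<longrightarrow> i < N \<longrightarrow> j < 2 * N + 2 \<longrightarrow>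
         code i (split_asg n (a (\<lambda>l. if l < N then h l (\<eta> l) else 0)) (b i (h i j))) =
           (if j < \<eta> i then A i else if j = \<eta> i then B i else C i)"
    by (elim exE conjE)
  define pos where "pos \<eta> = (\<lambda>l. if l < N then h l (\<eta> l) else 0)" for \<eta>
  define cell where "cell \<eta> i j = split_asg n (a (pos \<eta>)) (b i (h i j))" for \<eta> i j
  have hom': "code i (cell \<eta> i j) = (if j < \<eta> i then A i else if j = \<eta> i then B i else C i)"
    if "\<And>l. 0 < \<eta> l \<and> \<eta> l \<le> 2 * N" "i < N" "j < 2 * N + 2" for \<eta> i j
    using hom[rule_format, of \<eta> i j] that by (simp add: pos_def cell_def less_Suc_eq_le)
  have range_cell: "range (cell \<eta> i j) \<subseteq> univ M\<^sub>1 \<union> univ M\<^sub>2" for \<eta> i j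
    unfolding cell_def using ab by (intro range_split_asg) simp_all
  have AB: "fst (A i) = fst (B i)" "A i \<noteq> B i" if i: "i < N" for i
  proof -
    have B1: "code i (cell (\<lambda>_. 1) i 1) = B i" and A0: "code i (cell (\<lambda>_. 1) i 0) = A i"
      using hom'[of "\<lambda>_. 1" i 1] hom'[of "\<lambda>_. 1" i 0] i by simp_all
    have A1: "code i (cell (\<lambda>_. 2) i 1) = A i" and B2: "code i (cell (\<lambda>_. 2) i 2) = B i"
      using hom'[of "\<lambda>_. 2" i 1] hom'[of "\<lambda>_. 2" i 2] i by simp_all
    \<comment> \<open>The side of an entry of the first tuple depends only on \<eta>, which is the
      same for \<open>A1\<close> and \<open>B2\<close>. The side of a parameter entry depends only
      on the column, which is the same for \<open>A1\<close> and \<open>B1\<close>.\<close>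
    have "v \<in> fst (A i) \<longleftrightarrow> v \<in> fst (B i)" for v
    proof (cases "v < n")
      case True
      then show ?thesis
        unfolding A1[symmetric] B2[symmetric] by (simp add: code_def side_def cell_def split_asg_def)
    next
      case False
      then show ?thesis
        unfolding A1[symmetric] B1[symmetric] by (simp add: code_def side_def cell_def split_asg_def)
    qed
    then show "fst (A i) = fst (B i)" by blast
    \<comment> \<open>With \<eta> constantly 1, the formula \<open>\<phi> i\<close> holds at column
      1 and fails at column 0. These cells have codes \<open>B i\<close> and \<open>A i\<close>, so
      the codes cannot be equal.\<close>
    have "pos (\<lambda>_. 1) l < max R N" for l using hR i by (auto simp: pos_def less_max_iff_disj)
    moreover have "h i 0 < h i 1" "h i 1 < R" "h i 0 < R" "pos (\<lambda>_. 1) i = h i 1"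
      using hmono hR i by (auto simp: pos_def)
    ultimately have "sat (M\<^sub>1 \<oplus> M\<^sub>2) (cell (\<lambda>_. 1) i 1) [] (\<phi> i)"
      "\<not> sat (M\<^sub>1 \<oplus> M\<^sub>2) (cell (\<lambda>_. 1) i 0) [] (\<phi> i)"
      unfolding cell_def using i by (auto simp: sat[rule_format])
    then show "A i \<noteq> B i" using code_sat[OF _ range_cell range_cell] A0 B1 by metis
  qed
  define I where "I = {i. fst (snd (A i)) \<noteq> fst (snd (B i))}"
  \<comment> \<open>Sides agree always and left types agree outside \<open>I\<close>, so only the
    right types are left to differ.\<close>
  have I: "snd (snd (A i)) \<noteq> snd (snd (B i))" if "i < N" "i \<notin> I" for i
    using AB[OF that(1)] that(2) by (auto simp: I_def prod_eq_iff)
  \<comment> \<open>The new column \<open>j\<close> is the pair of old columns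
    \<open>2 * j + 1\<close> and \<open>2 * j + 2\<close>. Placing \<eta> at the even member makes
    the codes of the pair \<open>A i, A i\<close> before \<open>\<eta> i\<close>,
    \<open>A i, B i\<close> at it and \<open>C i, C i\<close> after it.\<close>
  define pos' where "pos' \<eta> = (\<lambda>l. 2 * \<eta> l + 2)" for \<eta> :: "nat \<Rightarrow> nat"
  have cells: "code i (cell (pos' \<eta>) i (2 * j + 1)) = (if j \<le> \<eta> i then A i else C i)"
    "code i (cell (pos' \<eta>) i (2 * j + 2)) = (if j < \<eta> i then A i else if j = \<eta> i then B i else C i)"
    if "\<forall>l. \<eta> l < N" "i < N" "j < N" for \<eta> i j
  proof -
    have *: "0 < pos' \<eta> l \<and> pos' \<eta> l \<le> 2 * N" for l using that(1)[rule_format, of l] by (simp add: pos'_def)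
    show "code i (cell (pos' \<eta>) i (2 * j + 1)) = (if j \<le> \<eta> i then A i else C i)"
      using hom'[OF *, of i "2 * j + 1"] that by (auto simp: pos'_def)
    show "code i (cell (pos' \<eta>) i (2 * j + 2)) = (if j < \<eta> i then A i else if j = \<eta> i then B i else C i)"
      using hom'[OF *, of i "2 * j + 2"] that by (auto simp: pos'_def)
  qed
  have "partial_pattern M\<^sub>1 n \<chi> I N"
    unfolding partial_pattern_def
  proof (intro exI conjI allI impI)
    fix \<eta> i j
    show "range (p\<^sub>1 \<circ> a (pos (pos' \<eta>))) \<subseteq> univ M\<^sub>1" using p(1) by (auto simp: proj_to_def)
    show "range (join_asg (k i) (p\<^sub>1 \<circ> b i (h i (2 * j + 1))) (p\<^sub>1 \<circ> b i (h i (2 * j + 2)))) \<subseteq> univ M\<^sub>1"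
      using p(1) by (intro range_join_asg) (auto simp: proj_to_def)
    assume H: "\<forall>l. \<eta> l < N" "i < N" "i \<in> I" "j < N"
    have "left i (cell (pos' \<eta>) i (2 * j + 1)) \<noteq> left i (cell (pos' \<eta>) i (2 * j + 2)) \<longleftrightarrow> \<eta> i = j"
      unfolding left_code cells[OF H(1,2,4)] using H(3)
      by (cases "j < \<eta> i"; cases "j = \<eta> i") (simp_all add: I_def)
    then show "sat M\<^sub>1 (split_asg n (p\<^sub>1 \<circ> a (pos (pos' \<eta>)))
        (join_asg (k i) (p\<^sub>1 \<circ> b i (h i (2 * j + 1))) (p\<^sub>1 \<circ> b i (h i (2 * j + 2))))) [] (\<chi> i) \<longleftrightarrow> \<eta> i = j"
      unfolding diff left_def cell_def comp_split_asg by simp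
  qed
  moreover have "partial_pattern M\<^sub>2 n \<chi> (- I) N"
    unfolding partial_pattern_def
  proof (intro exI conjI allI impI)
    fix \<eta> i j
    show "range (p\<^sub>2 \<circ> a (pos (pos' \<eta>))) \<subseteq> univ M\<^sub>2" using p(2) by (auto simp: proj_to_def)
    show "range (join_asg (k i) (p\<^sub>2 \<circ> b i (h i (2 * j + 1))) (p\<^sub>2 \<circ> b i (h i (2 * j + 2)))) \<subseteq> univ M\<^sub>2"
      using p(2) by (intro range_join_asg) (auto simp: proj_to_def)
    assume H: "\<forall>l. \<eta> l < N" "i < N" "i \<in> - I" "j < N"
    have "right i (cell (pos' \<eta>) i (2 * j + 1)) \<noteq> right i (cell (pos' \<eta>) i (2 * j + 2)) \<longleftrightarrow> \<eta> i = j"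
      unfolding right_code cells[OF H(1,2,4)] using H(3) I[OF H(2)]
      by (cases "j < \<eta> i"; cases "j = \<eta> i") simp_all
    then show "sat M\<^sub>2 (split_asg n (p\<^sub>2 \<circ> a (pos (pos' \<eta>)))
        (join_asg (k i) (p\<^sub>2 \<circ> b i (h i (2 * j + 1))) (p\<^sub>2 \<circ> b i (h i (2 * j + 2))))) [] (\<chi> i) \<longleftrightarrow> \<eta> i = j"
      unfolding diff right_def cell_def comp_split_asg by simp
  qed
  ultimately show ?thesis by blast
qed

text \<open>This and \<open>partial_pattern_cong\<close> supply the monotonicity and locality that
  \<open>koenig_bool\<close> asks for.\<close>

lemma partial_pattern_Suc:
  assumes "partial_pattern M n \<chi> I (Suc N)"
  shows "partial_pattern M n \<chi> I N"
proof -
  obtain a b where ab: "\<forall>\<eta>. range (a \<eta>) \<subseteq> univ M" "\<forall>i j. range (b i j) \<subseteq> univ M"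
    and sat: "\<forall>\<eta> i j. (\<forall>l. \<eta> l < Suc N) \<longrightarrow> i < Suc N \<longrightarrow> i \<in> I \<longrightarrow> j < Suc N \<longrightarrow>
      (sat M (split_asg n (a \<eta>) (b i j)) [] (\<chi> i) \<longleftrightarrow> \<eta> i = j)"
    using assms unfolding partial_pattern_def by (elim exE conjE)
  show ?thesis unfolding partial_pattern_def
    using ab sat by (intro exI[of _ a] exI[of _ b]) (simp add: less_SucI)
qed

lemma partial_pattern_cong:
  assumes "\<And>i. i < N \<Longrightarrow> i \<in> I \<longleftrightarrow> i \<in> I'"
  shows "partial_pattern M n \<chi> I N \<longleftrightarrow> partial_pattern M n \<chi> I' N"
  unfolding partial_pattern_def using assms by (intro ex_cong1 conj_cong refl) auto

theorem theorem4p4: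
  fixes \<tau> :: "'r vocab" and M\<^sub>1 M\<^sub>2 :: "('r, 'a) fo_struct"
  assumes "is_structure \<tau> M\<^sub>1"
    and "is_structure \<tau> M\<^sub>2"
    and "univ M\<^sub>1 \<inter> univ M\<^sub>2 = {}"
    and "strongly_dependent1 \<tau> (Th \<tau> M\<^sub>1)"
    and "strongly_dependent1 \<tau> (Th \<tau> M\<^sub>2)"
  shows "strongly_dependent1 (sum_vocab \<tau>) (Th (sum_vocab \<tau>) (M\<^sub>1 \<oplus> M\<^sub>2))"
proof (rule ccontr)
  assume "\<not> ?thesis"
  then obtain n k and \<phi> :: "nat \<Rightarrow> ('r lr_sym, nat) fm"
    where \<phi>: "\<forall>i. wff (sum_vocab \<tau>) 0 (\<phi> i) \<and> fm_frees (\<phi> i) \<subseteq> {..<n + k i}"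
      and pat: "\<forall>N. finite_pattern (M\<^sub>1 \<oplus> M\<^sub>2) n \<phi> N"
    unfolding strongly_dependent1_Th_iff not_not by (elim exE conjE)
  have "\<forall>i. \<exists>\<Psi>. finite \<Psi> \<and> (\<forall>\<psi>\<in>\<Psi>. wff \<tau> 0 \<psi> \<and> fm_frees \<psi> \<subseteq> fm_frees (\<phi> i)) \<and>
      determines M\<^sub>1 M\<^sub>2 0 \<Psi> (\<phi> i)"
    by (intro allI feferman_vaught[OF assms(1-3)]) (use \<phi> in simp)
  then obtain \<Psi> where \<Psi>: "\<forall>i. finite (\<Psi> i) \<and>
      (\<forall>\<psi>\<in>\<Psi> i. wff \<tau> 0 \<psi> \<and> fm_frees \<psi> \<subseteq> fm_frees (\<phi> i)) \<and> determines M\<^sub>1 M\<^sub>2 0 (\<Psi> i) (\<phi> i)"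
    unfolding choice_iff by (elim exE)
  have "\<forall>i. \<exists>\<chi>. wff \<tau> 0 \<chi> \<and> fm_frees \<chi> \<subseteq> {..<n + 2 * k i} \<and>
    (\<forall>(M :: ('r, 'a) fo_struct) a b b'. sat M (split_asg n a (join_asg (k i) b b')) [] \<chi> \<longleftrightarrow>
      {\<psi>\<in>\<Psi> i. sat M (split_asg n a b) [] \<psi>} \<noteq> {\<psi>\<in>\<Psi> i. sat M (split_asg n a b') [] \<psi>})"
  proof
    fix i
    have "\<forall>\<psi>\<in>\<Psi> i. wff \<tau> 0 \<psi> \<and> fm_frees \<psi> \<subseteq> {..<n + k i}"
      using \<Psi>[rule_format, of i] \<phi>[rule_format, of i] by blast
    then show "\<exists>\<chi>. wff \<tau> 0 \<chi> \<and> fm_frees \<chi> \<subseteq> {..<n + 2 * k i} \<and>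
      (\<forall>(M :: ('r, 'a) fo_struct) a b b'. sat M (split_asg n a (join_asg (k i) b b')) [] \<chi> \<longleftrightarrow>
        {\<psi>\<in>\<Psi> i. sat M (split_asg n a b) [] \<psi>} \<noteq> {\<psi>\<in>\<Psi> i. sat M (split_asg n a b') [] \<psi>})"
      using \<Psi> by (intro difference_formula_exists) simp_all
  qed
  then obtain \<chi> where \<chi>: "\<forall>i. wff \<tau> 0 (\<chi> i) \<and> fm_frees (\<chi> i) \<subseteq> {..<n + 2 * k i} \<and>
    (\<forall>(M :: ('r, 'a) fo_struct) a b b'. sat M (split_asg n a (join_asg (k i) b b')) [] (\<chi> i) \<longleftrightarrow>
      {\<psi>\<in>\<Psi> i. sat M (split_asg n a b) [] \<psi>} \<noteq> {\<psi>\<in>\<Psi> i. sat M (split_asg n a b') [] \<psi>})"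
    unfolding choice_iff by (elim exE)
  \<comment> \<open>The bit \<open>d i\<close> tells which summand carries row \<open>i\<close>. The
    division obtained for one size may differ from that for another, and \<open>koenig_bool\<close>
    produces a single one valid for all sizes.\<close>
  define P where "P N d \<longleftrightarrow> partial_pattern M\<^sub>1 n \<chi> {i. d i} N \<and> partial_pattern M\<^sub>2 n \<chi> {i. \<not> d i} N"
    for N d
  have "\<exists>d. P N d" for N
  proof -
    have "\<exists>I. partial_pattern M\<^sub>1 n \<chi> I N \<and> partial_pattern M\<^sub>2 n \<chi> (- I) N"
      by (rule partial_patterns_in_summands[where \<phi> = \<phi> and \<Psi> = \<Psi> and k = k])
        (use assms(1-3) \<phi> \<Psi> \<chi> pat in \<open>simp_all add: is_structure_def\<close>)
    then obtain I where "partial_pattern M\<^sub>1 n \<chi> I N" "partial_pattern M\<^sub>2 n \<chi> (- I) N" by blast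
    then have "P N (\<lambda>i. i \<in> I)" by (simp add: P_def Compl_eq)
    then show ?thesis by blast
  qed
  moreover have "P N d" if "P (Suc N) d" for N d
    using that partial_pattern_Suc unfolding P_def by blast
  moreover have "P N d'" if "P N d" "\<And>i. i < N \<Longrightarrow> d i = d' i" for N d d'
    using that(1) partial_pattern_cong[of N "{i. d i}" "{i. d' i}" M\<^sub>1 n \<chi>]
      partial_pattern_cong[of N "{i. \<not> d i}" "{i. \<not> d' i}" M\<^sub>2 n \<chi>] that(2) unfolding P_def by simp
  ultimately have "\<exists>d. \<forall>N. P N d" by (rule koenig_bool)
  then obtain d where d: "P N d" for N by blast
  have wff: "wff \<tau> 0 (\<chi> i) \<and> fm_frees (\<chi> i) \<subseteq> {..<n + 2 * k i}" for i using \<chi> by blast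
  \<comment> \<open>One of the two summands carries infinitely many rows, which is enough to refute
    its strong dependence.\<close>
  have "infinite {i. d i} \<or> infinite {i. \<not> d i}"
    using infinite_UNIV_nat finite_Un[of "{i. d i}" "{i. \<not> d i}"] by (simp add: Collect_disj_eq[symmetric])
  then show False
  proof
    assume "infinite {i. d i}"
    then have "\<not> strongly_dependent1 \<tau> (Th \<tau> M\<^sub>1)"
      by (rule partial_patterns_not_strongly_dependent1[where \<chi> = \<chi> and n = n and k = "\<lambda>i. 2 * k i"])
        (use d wff in \<open>simp_all add: P_def\<close>)
    then show False using assms(4) by blast
  next
    assume "infinite {i. \<not> d i}"
    then have "\<not> strongly_dependent1 \<tau> (Th \<tau> M\<^sub>2)"
      by (rule partial_patterns_not_strongly_dependent1[where \<chi> = \<chi> and n = n and k = "\<lambda>i. 2 * k i"])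
        (use d wff in \<open>simp_all add: P_def\<close>)
    then show False using assms(5) by blast
  qed
qed

end
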